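(* Let $N\geq 3$, let $q>2N$ and $m\in[1,2_*]$, where $2_*=\frac{2N}{N+2}$. Let $\rho\in L^q(\mathbb{R}^N)\cap L^m(\mathbb{R}^N)$ and let $u_\rho\in\mathcal{X}$ be the unique minimizer on $\mathcal{X}$ of the functional $$I_\rho(u)=\int_{\mathbb{R}^N}\left(1-\sqrt{1-|\nabla u|^2}\right)dx-\int_{\mathbb{R}^N}\rho u\,dx .$$ Then $u_\rho\in W^{2,2}_{\mathrm{loc}}(\mathbb{R}^N)$.
   Context: $D^{1,2}(\mathbb{R}^N)$ denotes the completion of $C_c^\infty(\mathbb{R}^N)$ with respect to the norm $\left(\int_{\mathbb{R}^N}|\nabla u|^2dx\right)^{1/2}$. The space $\mathcal{X}$ is the convex set $\mathcal{X}=D^{1,2}(\mathbb{R}^N)\cap\{u\in C^{0,1}(\mathbb{R}^N):\ |\nabla u|_\infty\le 1\}$, endowed with the norm $\|u\|_{\mathcal X}=\left(\int_{\mathbb{R}^N}|\nabla u|^2dx\right)^{1/2}$. For such $\rho$, the functional $I_\rho$ is well defined on $\mathcal{X}$ and has a unique minimizer $u_\rho$ there. *)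

theory Defs
  imports "HOL-Analysis.Analysis"
begin

fun iter_partial :: "'a::euclidean_space list \<Rightarrow> ('a \<Rightarrow> real) \<Rightarrow> ('a \<Rightarrow> real)" where
  "iter_partial [] f = f"
| "iter_partial (b # bs) f = (\<lambda>x. deriv (\<lambda>t. iter_partial bs f (x + t *\<^sub>R b)) 0)"

definition partial :: "'a::euclidean_space \<Rightarrow> ('a \<Rightarrow> real) \<Rightarrow> ('a \<Rightarrow> real)" where
  "partial b f = iter_partial [b] f"

definition smooth_fun :: "('a::euclidean_space \<Rightarrow> real) \<Rightarrow> bool" where
  "smooth_fun f \<longleftrightarrow> (\<forall>bs. set bs \<subseteq> Basis \<longrightarrow> iter_partial bs f differentiable_on UNIV)"

definition test_fun :: "('a::euclidean_space \<Rightarrow> real) \<Rightarrow> bool" where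
  "test_fun \<phi> \<longleftrightarrow> smooth_fun \<phi> \<and> compact (closure {x. \<phi> x \<noteq> 0})"

definition grad_fun :: "('a::euclidean_space \<Rightarrow> real) \<Rightarrow> ('a \<Rightarrow> 'a)" where
  "grad_fun \<phi> = (\<lambda>x. \<Sum>b\<in>Basis. partial b \<phi> x *\<^sub>R b)"

definition Lp :: "real \<Rightarrow> ('a::euclidean_space \<Rightarrow> real) \<Rightarrow> bool" where
  "Lp p f \<longleftrightarrow> f \<in> borel_measurable lebesgue \<and> integrable lebesgue (\<lambda>x. \<bar>f x\<bar> powr p)"

definition L1_loc :: "('a::euclidean_space \<Rightarrow> real) \<Rightarrow> bool" where
  "L1_loc f \<longleftrightarrow> f \<in> borel_measurable lebesgue \<and>
     (\<forall>K. compact K \<longrightarrow> set_integrable lebesgue K f)"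

definition L2_loc :: "('a::euclidean_space \<Rightarrow> real) \<Rightarrow> bool" where
  "L2_loc f \<longleftrightarrow> f \<in> borel_measurable lebesgue \<and>
     (\<forall>K. compact K \<longrightarrow> set_integrable lebesgue K (\<lambda>x. (f x)\<^sup>2))"

definition has_weak_gradient :: "('a::euclidean_space \<Rightarrow> real) \<Rightarrow> ('a \<Rightarrow> 'a) \<Rightarrow> bool" where
  "has_weak_gradient u g \<longleftrightarrow> L1_loc u \<and> (\<forall>b\<in>Basis. L1_loc (\<lambda>x. g x \<bullet> b)) \<and>
     (\<forall>\<phi> b. test_fun \<phi> \<longrightarrow> b \<in> Basis \<longrightarrow>
        (\<integral>x. u x * partial b \<phi> x \<partial>lebesgue) = - (\<integral>x. (g x \<bullet> b) * \<phi> x \<partial>lebesgue))"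

definition weak_grad :: "('a::euclidean_space \<Rightarrow> real) \<Rightarrow> ('a \<Rightarrow> 'a)" where
  "weak_grad u = (SOME g. has_weak_gradient u g)"

text \<open>D^{1,2}(R^N), N >= 3: the completion of C_c^infinity under the Dirichlet norm,
  realised as functions u (in L^{2^*}) that are limits of test functions with
  gradients converging in L^2 to the weak gradient of u, and converging to u in L^{2^*}.\<close>
definition crit_exp :: "'a::euclidean_space itself \<Rightarrow> real" where
  "crit_exp _ = 2 * real DIM('a) / (real DIM('a) - 2)"

definition D12 :: "('a::euclidean_space \<Rightarrow> real) \<Rightarrow> bool" where
  "D12 u \<longleftrightarrow> (\<exists>g. has_weak_gradient u g \<and> Lp 2 (\<lambda>x. norm (g x)) \<and>
     (\<exists>\<phi>::nat \<Rightarrow> 'a \<Rightarrow> real. (\<forall>k. test_fun (\<phi> k)) \<and>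
        (\<lambda>k. \<integral>x. (norm (grad_fun (\<phi> k) x - g x))\<^sup>2 \<partial>lebesgue) \<longlonglongrightarrow> 0 \<and>
        (\<forall>k. integrable lebesgue (\<lambda>x. (norm (grad_fun (\<phi> k) x - g x))\<^sup>2)) \<and>
        (\<forall>k. integrable lebesgue (\<lambda>x. \<bar>\<phi> k x - u x\<bar> powr crit_exp TYPE('a))) \<and>
        (\<lambda>k. \<integral>x. \<bar>\<phi> k x - u x\<bar> powr crit_exp TYPE('a) \<partial>lebesgue) \<longlonglongrightarrow> 0))"

definition Xset :: "('a::euclidean_space \<Rightarrow> real) set" where
  "Xset = {u. D12 u \<and> (\<exists>L. L-lipschitz_on UNIV u) \<and>
       (\<exists>g. has_weak_gradient u g \<and> (AE x in lebesgue. norm (g x) \<le> 1))}"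

definition I_rho :: "('a::euclidean_space \<Rightarrow> real) \<Rightarrow> ('a \<Rightarrow> real) \<Rightarrow> real" where
  "I_rho \<rho> u = (\<integral>x. 1 - sqrt (1 - (norm (weak_grad u x))\<^sup>2) \<partial>lebesgue)
              - (\<integral>x. \<rho> x * u x \<partial>lebesgue)"

definition W22_loc :: "('a::euclidean_space \<Rightarrow> real) \<Rightarrow> bool" where
  "W22_loc u \<longleftrightarrow> L2_loc u \<and> (\<exists>g. has_weak_gradient u g \<and>
     (\<forall>b\<in>Basis. L2_loc (\<lambda>x. g x \<bullet> b)) \<and>
     (\<forall>b\<in>Basis. \<exists>h. has_weak_gradient (\<lambda>x. g x \<bullet> b) h \<and>
        (\<forall>b'\<in>Basis. L2_loc (\<lambda>x. h x \<bullet> b'))))"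

end

theory Submission
  imports Defs "HOL-Computational_Algebra.Polynomial"
begin

text \<open>The convex set of admissible functions is translation invariant, so for every increment \<open>h\<close>
  the mean of \<open>u\<close> and its translate \<open>u(\<cdot> + h)\<close> is an admissible competitor. No cut-off, which could
  violate the gradient constraint, is needed. Since the energy density is uniformly convex, adding the
  minimality inequalities for \<open>h\<close> and \<open>-h\<close> bounds the squared \<open>L\<^sup>2\<close>-norm \<open>Q\<^sup>2\<close> of
  \<open>\<nabla>u(\<cdot> + h) - \<nabla>u\<close> by four times the integral of \<open>\<rho>\<close> against the second difference
  \<open>2u - u(\<cdot> + h) - u(\<cdot> - h)\<close>. The \<open>L\<^sup>2\<close>-norm of the latter is at most \<open>|h| Q\<close>, and
  \<open>\<rho> \<in> L\<^sup>2\<close> by interpolation, so \<open>Q \<le> 4 |h| \<parallel>\<rho>\<parallel>\<close>. Moving the difference quotients onto a test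
  function \<open>\<phi>\<close> shows that \<open>\<phi> \<mapsto> \<integral> \<nabla>u \<partial>\<phi>\<close> is bounded in \<open>L\<^sup>2\<close>, and the function representing this
  functional is, up to sign, the weak derivative of \<open>\<nabla>u\<close>.\<close>

section \<open>Square-integrable functions\<close>

definition square_integrable :: "'a measure \<Rightarrow> ('a \<Rightarrow> 'b::euclidean_space) \<Rightarrow> bool" where
  "square_integrable M f \<longleftrightarrow> f \<in> borel_measurable M \<and> integrable M (\<lambda>x. (norm (f x))\<^sup>2)"

definition L2_norm :: "'a measure \<Rightarrow> ('a \<Rightarrow> 'b::euclidean_space) \<Rightarrow> real" where
  "L2_norm M f = sqrt (\<integral>x. (norm (f x))\<^sup>2 \<partial>M)"

lemma square_integrable_measurable [measurable_dest]:
  "square_integrable M f \<Longrightarrow> f \<in> borel_measurable M"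
  by (simp add: square_integrable_def)

lemma square_integrable_integrable_norm_power2:
  "square_integrable M f \<Longrightarrow> integrable M (\<lambda>x. (norm (f x))\<^sup>2)"
  by (simp add: square_integrable_def)

lemma L2_norm_nonneg: "0 \<le> L2_norm M f"
  by (simp add: L2_norm_def)

lemma L2_norm_power2: "(L2_norm M f)\<^sup>2 = (\<integral>x. (norm (f x))\<^sup>2 \<partial>M)"
  by (simp add: L2_norm_def)

lemma nn_integral_power2_norm:
  "square_integrable M f \<Longrightarrow> (\<integral>\<^sup>+x. ennreal ((norm (f x))\<^sup>2) \<partial>M) = ennreal ((L2_norm M f)\<^sup>2)"
  unfolding L2_norm_power2
  by (intro nn_integral_eq_integral square_integrable_integrable_norm_power2) simp_all

lemma L2_boundI:
  assumes f_measurable: "f \<in> borel_measurable M" and "0 \<le> B"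
    and bound: "(\<integral>\<^sup>+x. ennreal ((norm (f x))\<^sup>2) \<partial>M) \<le> ennreal (B\<^sup>2)"
  shows "square_integrable M f" "L2_norm M f \<le> B"
proof -
  have "integrable M (\<lambda>x. (norm (f x))\<^sup>2)"
    using f_measurable bound
    by (intro integrableI_bounded) (auto simp: le_less_trans[OF _ ennreal_less_top])
  with f_measurable show "square_integrable M f" by (simp add: square_integrable_def)
  from bound have "(L2_norm M f)\<^sup>2 \<le> B\<^sup>2"
    by (simp add: nn_integral_power2_norm[OF \<open>square_integrable M f\<close>] ennreal_le_iff)
  then show "L2_norm M f \<le> B" using \<open>0 \<le> B\<close> by (rule power2_le_imp_le)
qed

lemma square_integrable_bound:
  assumes "square_integrable M g" "f \<in> borel_measurable M" "\<And>x. norm (f x) \<le> norm (g x)"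
  shows "square_integrable M f"
  unfolding square_integrable_def
proof
  show "integrable M (\<lambda>x. (norm (f x))\<^sup>2)"
  proof (rule Bochner_Integration.integrable_bound)
    show "integrable M (\<lambda>x. (norm (g x))\<^sup>2)"
      by (rule square_integrable_integrable_norm_power2[OF assms(1)])
    show "AE x in M. norm ((norm (f x))\<^sup>2) \<le> norm ((norm (g x))\<^sup>2)"
      using assms(3) by (simp add: power_mono)
  qed (use assms(2) in measurable)
qed (fact assms(2))

lemma L2_norm_mono:
  assumes "square_integrable M f" "square_integrable M g" "\<And>x. norm (f x) \<le> norm (g x)"
  shows "L2_norm M f \<le> L2_norm M g"
  unfolding L2_norm_def
  using assms
  by (intro real_sqrt_le_mono integral_mono square_integrable_integrable_norm_power2 power_mono) auto

lemma square_integrable_inner: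
  assumes [measurable]: "square_integrable M f" "square_integrable M g"
  shows "integrable M (\<lambda>x. f x \<bullet> g x)"
proof (rule Bochner_Integration.integrable_bound)
  show "integrable M (\<lambda>x. (norm (f x))\<^sup>2 + (norm (g x))\<^sup>2)"
    using assms by (simp add: square_integrable_def)
  have "\<bar>f x \<bullet> g x\<bar> \<le> (norm (f x))\<^sup>2 + (norm (g x))\<^sup>2" for x
    using Cauchy_Schwarz_ineq2[of "f x" "g x"] sum_squares_bound[of "norm (f x)" "norm (g x)"]
      mult_nonneg_nonneg[OF norm_ge_zero[of "f x"] norm_ge_zero[of "g x"]]
    by linarith
  then show "AE x in M. norm (f x \<bullet> g x) \<le> norm ((norm (f x))\<^sup>2 + (norm (g x))\<^sup>2)"
    by simp
qed measurable

lemma power2_norm_lincomb: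
  fixes u v :: "'b::euclidean_space"
  shows "(norm (a *\<^sub>R u + b *\<^sub>R v))\<^sup>2 = a\<^sup>2 * (norm u)\<^sup>2 + 2 * a * b * (u \<bullet> v) + b\<^sup>2 * (norm v)\<^sup>2"
  unfolding power2_norm_eq_inner
  by (simp add: inner_add_left inner_add_right inner_commute power2_eq_square algebra_simps)

lemma square_integrable_lincomb:
  assumes "square_integrable M f" "square_integrable M g"
  shows "square_integrable M (\<lambda>x. a *\<^sub>R f x + b *\<^sub>R g x)"
  unfolding square_integrable_def power2_norm_lincomb
  using assms square_integrable_inner[OF assms] by (auto simp: square_integrable_def)

lemma L2_norm_power2_lincomb:
  assumes "square_integrable M f" "square_integrable M g"
  shows "(L2_norm M (\<lambda>x. a *\<^sub>R f x + b *\<^sub>R g x))\<^sup>2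
    = a\<^sup>2 * (L2_norm M f)\<^sup>2 + 2 * a * b * (\<integral>x. f x \<bullet> g x \<partial>M) + b\<^sup>2 * (L2_norm M g)\<^sup>2"
  unfolding L2_norm_power2 power2_norm_lincomb
  using assms square_integrable_inner[OF assms] by (simp add: square_integrable_def)

lemma square_integrable_diff:
  "square_integrable M f \<Longrightarrow> square_integrable M g \<Longrightarrow> square_integrable M (\<lambda>x. f x - g x)"
  using square_integrable_lincomb[of M f g 1 "-1"] by simp

lemma square_integrable_mult_right:
  fixes f :: "'a \<Rightarrow> real"
  shows "square_integrable M f \<Longrightarrow> square_integrable M (\<lambda>x. a * f x)"
  using square_integrable_lincomb[of M f f a 0] by simp

lemma L2_Cauchy_Schwarz:
  assumes "square_integrable M f" "square_integrable M g"
  shows "\<bar>\<integral>x. f x \<bullet> g x \<partial>M\<bar> \<le> L2_norm M f * L2_norm M g"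
proof -
  have [measurable]: "f \<in> borel_measurable M" "g \<in> borel_measurable M"
    using assms by measurable
  have "integrable M (\<lambda>x. norm (f x) \<bullet> norm (g x))"
    using assms by (intro square_integrable_inner) (auto simp: square_integrable_def)
  then have norm_integrable: "integrable M (\<lambda>x. norm (f x) * norm (g x))"
    by simp
  have "ennreal ((\<integral>x. norm (f x) * norm (g x) \<partial>M)\<^sup>2)
      = (\<integral>\<^sup>+x. ennreal (norm (f x)) * ennreal (norm (g x)) \<partial>M)\<^sup>2"
    using nn_integral_eq_integral[OF norm_integrable]
    by (simp add: ennreal_mult[symmetric] ennreal_power)
  also have "\<dots> \<le> ennreal ((L2_norm M f * L2_norm M g)\<^sup>2)"
    using assms
      Cauchy_Schwarz_nn_integral[of "\<lambda>x. ennreal (norm (f x))" M "\<lambda>x. ennreal (norm (g x))"]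
    by (simp add: nn_integral_power2_norm ennreal_mult[symmetric] ennreal_power power_mult_distrib)
  finally have "(\<integral>x. norm (f x) * norm (g x) \<partial>M)\<^sup>2 \<le> (L2_norm M f * L2_norm M g)\<^sup>2"
    by (simp add: ennreal_le_iff)
  then have "(\<integral>x. norm (f x) * norm (g x) \<partial>M) \<le> L2_norm M f * L2_norm M g"
    by (rule power2_le_imp_le) (simp add: L2_norm_nonneg)
  moreover have "\<bar>\<integral>x. f x \<bullet> g x \<partial>M\<bar> \<le> (\<integral>x. norm (f x) * norm (g x) \<partial>M)"
    by (rule order_trans[OF integral_abs_bound integral_mono[OF integrable_abs norm_integrable]])
       (simp_all add: square_integrable_inner[OF assms] Cauchy_Schwarz_ineq2)
  ultimately show ?thesis by simp
qed

lemma L2_norm_scaleR: "L2_norm M (\<lambda>x. a *\<^sub>R f x) = \<bar>a\<bar> * L2_norm M f"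
  by (simp add: L2_norm_def power_mult_distrib real_sqrt_mult)

lemma L2_norm_mult_right:
  fixes f :: "'a \<Rightarrow> real"
  shows "L2_norm M (\<lambda>x. a * f x) = \<bar>a\<bar> * L2_norm M f"
  using L2_norm_scaleR[of M a f] by simp

lemma L2_norm_diff_commute: "L2_norm M (\<lambda>x. f x - g x) = L2_norm M (\<lambda>x. g x - f x)"
  by (simp add: L2_norm_def norm_minus_commute)

lemma L2_norm_triangle:
  assumes "square_integrable M f" "square_integrable M g"
  shows "L2_norm M (\<lambda>x. f x + g x) \<le> L2_norm M f + L2_norm M g"
proof (rule power2_le_imp_le)
  have "(L2_norm M (\<lambda>x. f x + g x))\<^sup>2
      = (L2_norm M f)\<^sup>2 + 2 * (\<integral>x. f x \<bullet> g x \<partial>M) + (L2_norm M g)\<^sup>2"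
    using L2_norm_power2_lincomb[OF assms, of 1 1] by simp
  also have "\<dots> \<le> (L2_norm M f + L2_norm M g)\<^sup>2"
    using L2_Cauchy_Schwarz[OF assms] by (simp add: power2_sum)
  finally show "(L2_norm M (\<lambda>x. f x + g x))\<^sup>2 \<le> (L2_norm M f + L2_norm M g)\<^sup>2" .
qed (simp add: L2_norm_nonneg)

lemma L2_norm_lincomb_le:
  assumes "square_integrable M f" "square_integrable M g"
  shows "L2_norm M (\<lambda>x. a *\<^sub>R f x + b *\<^sub>R g x) \<le> \<bar>a\<bar> * L2_norm M f + \<bar>b\<bar> * L2_norm M g"
  using L2_norm_triangle[OF square_integrable_lincomb[OF assms, of a 0]
    square_integrable_lincomb[OF assms, of 0 b]]
  by (simp add: L2_norm_scaleR)

lemma L2_norm_tendsto: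
  assumes f_L2: "\<And>n. square_integrable M (f n)" and g_L2: "square_integrable M g"
    and lim: "(\<lambda>n. L2_norm M (\<lambda>x. f n x - g x)) \<longlonglongrightarrow> 0"
  shows "(\<lambda>n. L2_norm M (f n)) \<longlonglongrightarrow> L2_norm M g"
proof (rule LIM_zero_cancel[OF Lim_null_comparison[OF _ lim]], intro always_eventually allI)
  fix n
  have "L2_norm M (f n) \<le> L2_norm M (\<lambda>x. f n x - g x) + L2_norm M g"
    using L2_norm_triangle[OF square_integrable_diff[OF f_L2 g_L2] g_L2, of n] by simp
  moreover have "L2_norm M g \<le> L2_norm M (\<lambda>x. f n x - g x) + L2_norm M (f n)"
    using L2_norm_triangle[OF square_integrable_diff[OF g_L2 f_L2] f_L2, of n n]
    by (simp add: L2_norm_diff_commute)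
  ultimately show "norm (L2_norm M (f n) - L2_norm M g) \<le> L2_norm M (\<lambda>x. f n x - g x)"
    by (simp add: abs_le_iff)
qed

lemma L2_inner_tendsto:
  assumes f_L2: "\<And>n. square_integrable M (f n)" and g_L2: "square_integrable M g"
    and h_L2: "square_integrable M h"
    and lim: "(\<lambda>n. L2_norm M (\<lambda>x. f n x - g x)) \<longlonglongrightarrow> 0"
  shows "(\<lambda>n. \<integral>x. f n x \<bullet> h x \<partial>M) \<longlonglongrightarrow> (\<integral>x. g x \<bullet> h x \<partial>M)"
proof (rule LIM_zero_cancel[OF Lim_null_comparison], intro always_eventually allI)
  fix n
  have "(\<integral>x. f n x \<bullet> h x \<partial>M) - (\<integral>x. g x \<bullet> h x \<partial>M) = (\<integral>x. (f n x - g x) \<bullet> h x \<partial>M)"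
    using square_integrable_inner[OF f_L2 h_L2] square_integrable_inner[OF g_L2 h_L2]
    by (simp add: inner_diff_left)
  then show "norm ((\<integral>x. f n x \<bullet> h x \<partial>M) - (\<integral>x. g x \<bullet> h x \<partial>M))
      \<le> L2_norm M (\<lambda>x. f n x - g x) * L2_norm M h"
    using L2_Cauchy_Schwarz[OF square_integrable_diff[OF f_L2 g_L2] h_L2] by simp
  show "(\<lambda>n. L2_norm M (\<lambda>x. f n x - g x) * L2_norm M h) \<longlonglongrightarrow> 0"
    using lim by (rule tendsto_mult_left_zero)
qed

lemma L2_tendsto_lincomb:
  assumes f_L2: "\<And>n. square_integrable M (\<lambda>x. f n x - f' x)"
    and g_L2: "\<And>n. square_integrable M (\<lambda>x. g n x - g' x)"
    and lim: "(\<lambda>n. L2_norm M (\<lambda>x. f n x - f' x)) \<longlonglongrightarrow> 0" "(\<lambda>n. L2_norm M (\<lambda>x. g n x - g' x)) \<longlonglongrightarrow> 0"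
  shows "(\<lambda>n. L2_norm M (\<lambda>x. (a *\<^sub>R f n x + b *\<^sub>R g n x) - (a *\<^sub>R f' x + b *\<^sub>R g' x))) \<longlonglongrightarrow> 0"
proof (rule Lim_null_comparison[OF always_eventually[OF allI]])
  fix n
  have "(a *\<^sub>R f n x + b *\<^sub>R g n x) - (a *\<^sub>R f' x + b *\<^sub>R g' x)
      = a *\<^sub>R (f n x - f' x) + b *\<^sub>R (g n x - g' x)" for x
    by (simp add: algebra_simps)
  then show "norm (L2_norm M (\<lambda>x. (a *\<^sub>R f n x + b *\<^sub>R g n x) - (a *\<^sub>R f' x + b *\<^sub>R g' x)))
      \<le> \<bar>a\<bar> * L2_norm M (\<lambda>x. f n x - f' x) + \<bar>b\<bar> * L2_norm M (\<lambda>x. g n x - g' x)"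
    using L2_norm_lincomb_le[OF f_L2 g_L2] by (simp add: L2_norm_nonneg)
  show "(\<lambda>n. \<bar>a\<bar> * L2_norm M (\<lambda>x. f n x - f' x) + \<bar>b\<bar> * L2_norm M (\<lambda>x. g n x - g' x)) \<longlonglongrightarrow> 0"
    by (intro tendsto_add_zero tendsto_mult_right_zero lim)
qed

lemma square_integrable_component:
  assumes "square_integrable M f" "b \<in> Basis"
  shows "square_integrable M (\<lambda>x. f x \<bullet> b)"
  using assms by (auto intro: square_integrable_bound[of M f] simp: Basis_le_norm)

lemma square_integrable_euclideanI:
  fixes f :: "'a \<Rightarrow> 'b::euclidean_space"
  assumes components: "\<And>b. b \<in> Basis \<Longrightarrow> square_integrable M (\<lambda>x. f x \<bullet> b)"
  shows "square_integrable M f"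
proof -
  have "(norm (f x))\<^sup>2 = (\<Sum>b\<in>Basis. (norm (f x \<bullet> b))\<^sup>2)" for x
    unfolding power2_norm_eq_inner by (subst euclidean_inner) (simp add: power2_eq_square)
  moreover have "f \<in> borel_measurable M"
    unfolding borel_measurable_euclidean_space[of f]
    using components by (simp add: square_integrable_def)
  ultimately show ?thesis
    using components by (simp add: square_integrable_def)
qed

lemma L2_Fatou:
  fixes f :: "nat \<Rightarrow> 'a \<Rightarrow> 'b::euclidean_space"
  assumes f_L2: "\<And>n. square_integrable M (f n)"
    and bound: "\<And>n. L2_norm M (f n) \<le> bd n" and bd_lim: "bd \<longlonglongrightarrow> B"
    and g_measurable [measurable]: "g \<in> borel_measurable M" and lim: "AE x in M. (\<lambda>n. f n x) \<longlonglongrightarrow> g x"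
  shows "square_integrable M g" "L2_norm M g \<le> B"
proof -
  have [measurable]: "f n \<in> borel_measurable M" for n
    using f_L2 by (rule square_integrable_measurable)
  have bd_nonneg: "0 \<le> bd n" for n using L2_norm_nonneg bound by (rule order_trans)
  have "0 \<le> B" using LIMSEQ_le_const[OF bd_lim] bd_nonneg by blast
  have "(\<integral>\<^sup>+x. ennreal ((norm (g x))\<^sup>2) \<partial>M) = (\<integral>\<^sup>+x. liminf (\<lambda>n. ennreal ((norm (f n x))\<^sup>2)) \<partial>M)"
  proof (rule nn_integral_cong_AE)
    show "AE x in M. ennreal ((norm (g x))\<^sup>2) = liminf (\<lambda>n. ennreal ((norm (f n x))\<^sup>2))"
      using lim
    proof eventually_elim
      case (elim x)
      then have "(\<lambda>n. ennreal ((norm (f n x))\<^sup>2)) \<longlonglongrightarrow> ennreal ((norm (g x))\<^sup>2)"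
        by (intro tendsto_ennrealI tendsto_power tendsto_norm)
      then show ?case by (intro lim_imp_Liminf[symmetric]) auto
    qed
  qed
  also have "\<dots> \<le> liminf (\<lambda>n. \<integral>\<^sup>+x. ennreal ((norm (f n x))\<^sup>2) \<partial>M)"
    by (rule nn_integral_liminf) measurable
  also have "\<dots> \<le> liminf (\<lambda>n. ennreal ((bd n)\<^sup>2))"
  proof (intro Liminf_mono always_eventually allI)
    fix n
    show "(\<integral>\<^sup>+x. ennreal ((norm (f n x))\<^sup>2) \<partial>M) \<le> ennreal ((bd n)\<^sup>2)"
      unfolding nn_integral_power2_norm[OF f_L2]
      by (intro ennreal_leI power_mono bound L2_norm_nonneg)
  qed
  also have "\<dots> = ennreal (B\<^sup>2)"
    using bd_lim by (intro lim_imp_Liminf tendsto_ennrealI tendsto_power) auto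
  finally have "(\<integral>\<^sup>+x. ennreal ((norm (g x))\<^sup>2) \<partial>M) \<le> ennreal (B\<^sup>2)" .
  then show "square_integrable M g" "L2_norm M g \<le> B"
    using L2_boundI[OF g_measurable \<open>0 \<le> B\<close>] by blast+
qed

subsection \<open>Completeness\<close>

lemma L2_Chebyshev_inequality:
  assumes f_L2: "square_integrable M f" and "e > 0" and "L2_norm M f \<le> e"
  shows "emeasure M {x \<in> space M. (norm (f x))\<^sup>2 \<ge> e} \<le> ennreal e"
proof -
  have "(L2_norm M f)\<^sup>2 \<le> e * e"
    unfolding power2_eq_square using assms by (intro mult_mono L2_norm_nonneg) auto
  then have "1 / e * (\<integral>x. (norm (f x))\<^sup>2 \<partial>M) \<le> e"
    using \<open>e > 0\<close> by (simp add: L2_norm_power2 divide_le_eq)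
  with integral_Markov_inequality[OF square_integrable_integrable_norm_power2[OF f_L2] _ \<open>e > 0\<close>]
  show ?thesis by (auto intro: order_trans ennreal_leI)
qed

lemma geometric_steps_imp_convergent:
  fixes x :: "nat \<Rightarrow> 'b::banach"
  assumes "eventually (\<lambda>n. norm (x (Suc n) - x n) \<le> (1/2) ^ n) sequentially"
  shows "convergent x"
proof -
  have "summable (\<lambda>n. x (Suc n) - x n)"
    using assms by (rule summable_comparison_test_ev) (simp add: summable_geometric)
  then have "convergent (\<lambda>n. x n - x 0)"
    by (simp only: summable_iff_convergent sum_lessThan_telescope)
  then show ?thesis by (simp add: convergent_diff_const_right_iff)
qed

lemma L2_fast_Cauchy_AE_convergent:
  fixes f :: "nat \<Rightarrow> 'a \<Rightarrow> 'b::euclidean_space"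
  assumes f_L2: "\<And>n. square_integrable M (f n)"
    and fast: "\<And>n. L2_norm M (\<lambda>x. f (Suc n) x - f n x) \<le> (1/4) ^ n"
  shows "AE x in M. convergent (\<lambda>n. f n x)"
proof -
  have [measurable]: "f n \<in> borel_measurable M" for n
    using f_L2 by (rule square_integrable_measurable)
  have quarter_power: "(1/4 :: real) ^ n = ((1/2) ^ n)\<^sup>2" for n
    by (simp add: power2_eq_square flip: power_mult_distrib)
  define jump where "jump n = {x \<in> space M. (norm (f (Suc n) x - f n x))\<^sup>2 \<ge> (1/4) ^ n}" for n
  have jump_sets: "jump n \<in> sets M" for n unfolding jump_def by measurable
  have emeasure_jump: "emeasure M (jump n) \<le> ennreal ((1/4) ^ n)" for n
    unfolding jump_def by (intro L2_Chebyshev_inequality square_integrable_diff f_L2 fast) simp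
  have "AE x in M. eventually (\<lambda>n. x \<in> space M - jump n) sequentially"
  proof (rule borel_cantelli_AE1[OF jump_sets])
    show "emeasure M (jump n) < \<infinity>" for n
      using le_less_trans[OF emeasure_jump ennreal_less_top] by simp
    have "measure M (jump n) \<le> (1/4) ^ n" for n
      unfolding measure_def by (rule enn2real_leI[OF _ emeasure_jump]) simp
    then show "summable (\<lambda>n. measure M (jump n))"
      by (intro summable_comparison_test[OF _ summable_geometric[of "1/4"]]) auto
  qed
  then show ?thesis
  proof eventually_elim
    case (elim x)
    then have "eventually (\<lambda>n. norm (f (Suc n) x - f n x) \<le> (1/2) ^ n) sequentially"
    proof eventually_elim
      case (elim n)
      then have "(norm (f (Suc n) x - f n x))\<^sup>2 \<le> ((1/2) ^ n)\<^sup>2"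
        by (auto simp: jump_def not_le less_imp_le simp flip: quarter_power)
      then show ?case by (rule power2_le_imp_le) simp
    qed
    then show ?case by (rule geometric_steps_imp_convergent)
  qed
qed

lemma L2_Cauchy_tail_limit:
  fixes f :: "nat \<Rightarrow> 'a \<Rightarrow> 'b::euclidean_space"
  assumes f_L2: "\<And>n. square_integrable M (f n)" and g_measurable: "g \<in> borel_measurable M"
    and r_ge: "\<And>k. r k \<ge> k" and lim: "AE x in M. (\<lambda>k. f (r k) x) \<longlonglongrightarrow> g x"
    and tail: "\<forall>i\<ge>N. \<forall>j\<ge>N. L2_norm M (\<lambda>x. f i x - f j x) < e" and "n \<ge> N"
  shows "square_integrable M (\<lambda>x. f n x - g x)" "L2_norm M (\<lambda>x. f n x - g x) \<le> e"
proof -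
  have diff_le: "L2_norm M (\<lambda>x. f n x - f (r (k + N)) x) \<le> e" for k
    using tail \<open>n \<ge> N\<close> r_ge[of "k + N"] by (intro less_imp_le) auto
  have diff_lim: "AE x in M. (\<lambda>k. f n x - f (r (k + N)) x) \<longlonglongrightarrow> f n x - g x"
    using lim by eventually_elim (intro tendsto_diff tendsto_const LIMSEQ_ignore_initial_segment)
  have "(\<lambda>x. f n x - g x) \<in> borel_measurable M"
    by (intro borel_measurable_diff square_integrable_measurable f_L2 g_measurable)
  note Fatou = L2_Fatou[OF square_integrable_diff[OF f_L2 f_L2] diff_le tendsto_const this diff_lim]
  show "square_integrable M (\<lambda>x. f n x - g x)" "L2_norm M (\<lambda>x. f n x - g x) \<le> e"
    by (rule Fatou)+
qed

theorem L2_complete: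
  fixes f :: "nat \<Rightarrow> 'a \<Rightarrow> 'b::euclidean_space"
  assumes f_L2: "\<And>n. square_integrable M (f n)"
    and Cauchy: "\<And>e. e > 0 \<Longrightarrow> \<exists>N. \<forall>i\<ge>N. \<forall>j\<ge>N. L2_norm M (\<lambda>x. f i x - f j x) < e"
  obtains g where "square_integrable M g" "(\<lambda>n. L2_norm M (\<lambda>x. f n x - g x)) \<longlonglongrightarrow> 0"
proof -
  have [measurable]: "f n \<in> borel_measurable M" for n
    using f_L2 by (rule square_integrable_measurable)
  have "\<forall>k. \<exists>N. \<forall>i\<ge>N. \<forall>j\<ge>N. L2_norm M (\<lambda>x. f i x - f j x) < (1/4) ^ k"
    using Cauchy by simp
  then obtain N where
    N_Cauchy: "\<And>k i j. i \<ge> N k \<Longrightarrow> j \<ge> N k \<Longrightarrow> L2_norm M (\<lambda>x. f i x - f j x) < (1/4) ^ k"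
    by metis
  define r where "r k = (\<Sum>i\<le>k. N i) + k" for k
  have "N k \<le> (\<Sum>i\<le>k. N i)" for k
    by (rule member_le_sum) auto
  then have r_ge: "r k \<ge> k" and "r k \<ge> N k" "r (Suc k) \<ge> N k" for k
    by (auto simp: r_def intro: le_SucI trans_le_add1)
  then have "AE x in M. convergent (\<lambda>k. f (r k) x)"
    by (intro L2_fast_Cauchy_AE_convergent f_L2 less_imp_le[OF N_Cauchy])
  define g where "g x = lim (\<lambda>k. f (r k) x)" for x
  have [measurable]: "g \<in> borel_measurable M"
    unfolding g_def[abs_def] by measurable
  have lim: "AE x in M. (\<lambda>k. f (r k) x) \<longlonglongrightarrow> g x"
    using \<open>AE x in M. convergent (\<lambda>k. f (r k) x)\<close> by (simp add: g_def convergent_LIMSEQ_iff)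
  note tail_bound = L2_Cauchy_tail_limit[OF f_L2 \<open>g \<in> borel_measurable M\<close> r_ge lim]
  obtain K where "\<forall>i\<ge>K. \<forall>j\<ge>K. L2_norm M (\<lambda>x. f i x - f j x) < 1" using Cauchy[of 1] by auto
  from square_integrable_diff[OF f_L2[of K] tail_bound(1)[OF this order_refl]]
  have "square_integrable M g" by simp
  moreover have "(\<lambda>n. L2_norm M (\<lambda>x. f n x - g x)) \<longlonglongrightarrow> 0"
  proof (rule LIMSEQ_I)
    fix e :: real assume "e > 0"
    then obtain K where K_Cauchy: "\<forall>i\<ge>K. \<forall>j\<ge>K. L2_norm M (\<lambda>x. f i x - f j x) < e/2"
      using Cauchy[of "e/2"] by auto
    show "\<exists>K. \<forall>n\<ge>K. norm (L2_norm M (\<lambda>x. f n x - g x) - 0) < e"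
      using tail_bound(2)[OF K_Cauchy] \<open>e > 0\<close>
      by (intro exI[of _ K]) (fastforce simp: L2_norm_nonneg)
  qed
  ultimately show ?thesis by (rule that)
qed

subsection \<open>Representation of bounded functionals\<close>

lemma nonneg_quadratic_imp_linear_coeff_zero:
  fixes b c :: real
  assumes nonneg: "\<And>t. 0 \<le> 2 * t * b + t\<^sup>2 * c"
  shows "b = 0"
proof -
  define s where "s = inverse (\<bar>c\<bar> + 1)"
  have s_bounds: "s > 0" "s * \<bar>c\<bar> \<le> 1" by (auto simp: s_def field_simps)
  have "(- s * b)\<^sup>2 * c = s * b\<^sup>2 * (s * c)"
    by (simp add: power2_eq_square)
  also have "\<dots> \<le> s * b\<^sup>2 * 1"
    using s_bounds
    by (intro mult_left_mono order_trans[OF mult_left_mono[OF abs_ge_self] s_bounds(2)]) auto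
  finally have "s * b\<^sup>2 \<le> 0"
    using nonneg[of "- s * b"] by (simp add: power2_eq_square)
  then show ?thesis using s_bounds by (simp add: mult_le_0_iff)
qed

text \<open>Minimizing \<open>\<parallel>f\<parallel>\<^sup>2 - 2 T f\<close> over \<open>V\<close>: near minimizers are close to each other by the
  parallelogram identity, and the vanishing first variation at their limit says that the limit
  represents \<open>T\<close>.\<close>

locale bounded_L2_functional =
  fixes M :: "'a measure" and V :: "('a \<Rightarrow> 'b::euclidean_space) set" and T :: "('a \<Rightarrow> 'b) \<Rightarrow> real"
    and C :: real
  assumes square_integrable: "f \<in> V \<Longrightarrow> square_integrable M f"
    and nonempty: "V \<noteq> {}"
    and lincomb_closed: "f \<in> V \<Longrightarrow> g \<in> V \<Longrightarrow> (\<lambda>x. a *\<^sub>R f x + b *\<^sub>R g x) \<in> V"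
    and linear: "f \<in> V \<Longrightarrow> g \<in> V \<Longrightarrow> T (\<lambda>x. a *\<^sub>R f x + b *\<^sub>R g x) = a * T f + b * T g"
    and bounded: "f \<in> V \<Longrightarrow> \<bar>T f\<bar> \<le> C * L2_norm M f"
begin

definition energy :: "('a \<Rightarrow> 'b) \<Rightarrow> real" where
  "energy f = (L2_norm M f)\<^sup>2 - 2 * T f"

lemma energy_lower_bound:
  assumes "f \<in> V"
  shows "- C\<^sup>2 \<le> energy f"
proof -
  have "0 \<le> (L2_norm M f - C)\<^sup>2" by simp
  also have "\<dots> = (L2_norm M f)\<^sup>2 - 2 * (C * L2_norm M f) + C\<^sup>2"
    by (simp add: power2_diff)
  finally show ?thesis
    using bounded[OF assms] by (simp add: energy_def)
qed

lemma energy_perturbation: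
  assumes "f \<in> V" "g \<in> V"
  shows "energy (\<lambda>x. f x + t *\<^sub>R g x)
    = energy f + 2 * t * ((\<integral>x. f x \<bullet> g x \<partial>M) - T g) + t\<^sup>2 * (L2_norm M g)\<^sup>2"
  using L2_norm_power2_lincomb[OF assms[THEN square_integrable], of 1 t] linear[OF assms, of 1 t]
  by (simp add: energy_def algebra_simps)

lemma energy_parallelogram:
  assumes "f \<in> V" "g \<in> V"
  shows "(L2_norm M (\<lambda>x. f x - g x))\<^sup>2
    = 2 * energy f + 2 * energy g - 4 * energy (\<lambda>x. (1/2) *\<^sub>R f x + (1/2) *\<^sub>R g x)"
  using L2_norm_power2_lincomb[OF assms[THEN square_integrable], of 1 "-1"]
    L2_norm_power2_lincomb[OF assms[THEN square_integrable], of "1/2" "1/2"]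
    linear[OF assms, of "1/2" "1/2"]
  by (simp add: energy_def power2_eq_square)

definition min_energy :: real where
  "min_energy = (INF f\<in>V. energy f)"

lemma min_energy_le:
  assumes "f \<in> V"
  shows "min_energy \<le> energy f"
  unfolding min_energy_def
  using assms energy_lower_bound by (intro cINF_lower bdd_belowI2)

lemma near_minimizers_close:
  assumes "f \<in> V" "g \<in> V" "energy f < min_energy + e" "energy g < min_energy + e"
  shows "(L2_norm M (\<lambda>x. f x - g x))\<^sup>2 < 4 * e"
  using energy_parallelogram[OF assms(1,2)]
    min_energy_le[OF lincomb_closed[OF assms(1,2), of "1/2" "1/2"]] assms(3,4)
  by linarith

lemma ex_near_minimizer:
  assumes "e > 0"
  shows "\<exists>f\<in>V. energy f < min_energy + e"
  using cInf_lessD[of "energy ` V" "min_energy + e"] nonempty assms by (auto simp: min_energy_def)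

lemma minimizing_sequence_Cauchy:
  assumes f_V: "\<And>n. f n \<in> V" and energy_f: "\<And>n. energy (f n) < min_energy + inverse (real (Suc n))"
    and "e > 0"
  shows "\<exists>N. \<forall>i\<ge>N. \<forall>j\<ge>N. L2_norm M (\<lambda>x. f i x - f j x) < e"
proof -
  obtain N where N_small: "inverse (real (Suc N)) < e\<^sup>2 / 4"
    using reals_Archimedean[of "e\<^sup>2 / 4"] \<open>e > 0\<close> by auto
  have "energy (f i) < min_energy + e\<^sup>2 / 4" if "i \<ge> N" for i
  proof -
    have "inverse (real (Suc i)) \<le> inverse (real (Suc N))" using that by simp
    with energy_f[of i] N_small show ?thesis by linarith
  qed
  then have "(L2_norm M (\<lambda>x. f i x - f j x))\<^sup>2 < e\<^sup>2" if "i \<ge> N" "j \<ge> N" for i j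
    using near_minimizers_close[OF f_V f_V, of i "e\<^sup>2 / 4" j] that by simp
  then show ?thesis
    using \<open>e > 0\<close> by (meson less_imp_le power2_less_imp_less)
qed

theorem Riesz_representation:
  obtains g where "square_integrable M g" "\<And>f. f \<in> V \<Longrightarrow> (\<integral>x. g x \<bullet> f x \<partial>M) = T f"
proof -
  have "\<forall>n. \<exists>f\<in>V. energy f < min_energy + inverse (real (Suc n))"
    by (simp add: ex_near_minimizer)
  then obtain f where f_V: "\<And>n. f n \<in> V"
    and energy_f: "\<And>n. energy (f n) < min_energy + inverse (real (Suc n))"
    by metis
  from f_V obtain g where g_L2: "square_integrable M g"
    and lim: "(\<lambda>n. L2_norm M (\<lambda>x. f n x - g x)) \<longlonglongrightarrow> 0"
    using L2_complete[OF _ minimizing_sequence_Cauchy[OF f_V energy_f]] square_integrable by blast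
  have "(\<integral>x. g x \<bullet> h x \<partial>M) = T h" if h_V: "h \<in> V" for h
  proof -
    define first_variation where "first_variation n = (\<integral>x. f n x \<bullet> h x \<partial>M) - T h" for n
    have first_variation_lim: "first_variation \<longlonglongrightarrow> (\<integral>x. g x \<bullet> h x \<partial>M) - T h"
      unfolding first_variation_def
      by (intro tendsto_diff tendsto_const
        L2_inner_tendsto[OF square_integrable[OF f_V] g_L2 square_integrable[OF h_V] lim])
    have "0 \<le> 2 * t * ((\<integral>x. g x \<bullet> h x \<partial>M) - T h) + t\<^sup>2 * (L2_norm M h)\<^sup>2" for t
    proof (rule LIMSEQ_le_const)
      show "(\<lambda>n. inverse (real (Suc n)) + 2 * t * first_variation n + t\<^sup>2 * (L2_norm M h)\<^sup>2)
          \<longlonglongrightarrow> 2 * t * ((\<integral>x. g x \<bullet> h x \<partial>M) - T h) + t\<^sup>2 * (L2_norm M h)\<^sup>2"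
        using tendsto_add[OF LIMSEQ_inverse_real_of_nat tendsto_mult_left[OF first_variation_lim]]
        by (intro tendsto_add tendsto_const) simp
      have "0 \<le> inverse (real (Suc n)) + 2 * t * first_variation n + t\<^sup>2 * (L2_norm M h)\<^sup>2" for n
        using min_energy_le[OF lincomb_closed[OF f_V h_V, of 1 n t]]
          energy_perturbation[OF f_V h_V, of n t] energy_f[of n]
        by (simp add: first_variation_def)
      then show "\<exists>N. \<forall>n\<ge>N. 0 \<le> inverse (real (Suc n)) + 2 * t * first_variation n
          + t\<^sup>2 * (L2_norm M h)\<^sup>2"
        by blast
    qed
    from nonneg_quadratic_imp_linear_coeff_zero[OF this] show ?thesis by simp
  qed
  with g_L2 show ?thesis by (rule that)
qed

end

section \<open>Translations of Lebesgue measure\<close>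

lemma lebesgue_measurable_shift [measurable]:
  "(\<lambda>x::'a::euclidean_space. x + h) \<in> lebesgue \<rightarrow>\<^sub>M lebesgue"
  using lebesgue_affine_measurable[of "\<lambda>_. 1" h]
  by (simp add: euclidean_representation add.commute)

lemma distr_lebesgue_shift:
  "distr lebesgue lebesgue (\<lambda>x::'a::euclidean_space. x + h) = lebesgue"
  using lebesgue_affine_euclidean[of "\<lambda>_. 1" h]
  by (simp add: euclidean_representation add.commute density_1)

lemma AE_lebesgue_shift:
  assumes "AE x in lebesgue. P x"
  shows "AE x in lebesgue. P (x + h)"
  using AE_distrD[OF lebesgue_measurable_shift, of P h] assms by (simp only: distr_lebesgue_shift)

lemma borel_measurable_lebesgue_shift:
  assumes "f \<in> borel_measurable lebesgue"
  shows "(\<lambda>x. f (x + h)) \<in> borel_measurable lebesgue"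
  using measurable_compose[OF lebesgue_measurable_shift assms] .

lemma integrable_lebesgue_shift:
  fixes f :: "'a::euclidean_space \<Rightarrow> 'b::{banach, second_countable_topology}"
  assumes "integrable lebesgue f"
  shows "integrable lebesgue (\<lambda>x. f (x + h))"
  using integrable_distr[OF lebesgue_measurable_shift, of h f] assms
  by (simp only: distr_lebesgue_shift)

lemma integral_lebesgue_shift:
  fixes f :: "'a::euclidean_space \<Rightarrow> 'b::{banach, second_countable_topology}"
  assumes "f \<in> borel_measurable lebesgue"
  shows "(\<integral>x. f (x + h) \<partial>lebesgue) = (\<integral>x. f x \<partial>lebesgue)"
  using integral_distr[OF lebesgue_measurable_shift assms, of h]
  by (simp only: distr_lebesgue_shift)

lemma square_integrable_shift:
  "square_integrable lebesgue f \<Longrightarrow> square_integrable lebesgue (\<lambda>x. f (x + h))"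
  unfolding square_integrable_def
  using integrable_lebesgue_shift[of "\<lambda>x. (norm (f x))\<^sup>2" h]
  by (simp add: borel_measurable_lebesgue_shift)

lemma L2_norm_shift:
  assumes "square_integrable lebesgue f"
  shows "L2_norm lebesgue (\<lambda>x. f (x + h)) = L2_norm lebesgue f"
  using integral_lebesgue_shift[of "\<lambda>x. (norm (f x))\<^sup>2" h] assms
  by (simp add: L2_norm_def square_integrable_def)

lemma square_integrable_increment:
  "square_integrable lebesgue f \<Longrightarrow> square_integrable lebesgue (\<lambda>x. f (x + h) - f x)"
  by (intro square_integrable_diff square_integrable_shift)

lemma L2_norm_increment_uminus:
  assumes "square_integrable lebesgue f"
  shows "L2_norm lebesgue (\<lambda>x. f (x - h) - f x) = L2_norm lebesgue (\<lambda>x. f (x + h) - f x)"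
  using L2_norm_shift[OF square_integrable_increment[OF assms, of h], of "- h"]
  by (simp add: L2_norm_diff_commute)

lemma L2_norm_increment_of_nat_mult:
  assumes f_L2: "square_integrable lebesgue f"
  shows "L2_norm lebesgue (\<lambda>x. f (x + real n *\<^sub>R h) - f x)
      \<le> real n * L2_norm lebesgue (\<lambda>x. f (x + h) - f x)"
proof (induction n)
  case 0
  then show ?case by (simp add: L2_norm_def)
next
  case (Suc n)
  have shifted_increment_L2:
    "square_integrable lebesgue (\<lambda>x. f (x + real n *\<^sub>R h + h) - f (x + real n *\<^sub>R h))"
    by (rule square_integrable_shift[OF square_integrable_increment[OF f_L2]])
  have "f (x + real (Suc n) *\<^sub>R h) - f x
      = (f (x + real n *\<^sub>R h + h) - f (x + real n *\<^sub>R h)) + (f (x + real n *\<^sub>R h) - f x)" for x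
    by (simp add: algebra_simps)
  then have "L2_norm lebesgue (\<lambda>x. f (x + real (Suc n) *\<^sub>R h) - f x)
      \<le> L2_norm lebesgue (\<lambda>x. f (x + real n *\<^sub>R h + h) - f (x + real n *\<^sub>R h))
        + L2_norm lebesgue (\<lambda>x. f (x + real n *\<^sub>R h) - f x)"
    using L2_norm_triangle[OF shifted_increment_L2 square_integrable_increment[OF f_L2]]
    by (simp only:)
  also have "\<dots> \<le> L2_norm lebesgue (\<lambda>x. f (x + h) - f x)
      + real n * L2_norm lebesgue (\<lambda>x. f (x + h) - f x)"
    using L2_norm_shift[OF square_integrable_increment[OF f_L2, of h], of "real n *\<^sub>R h"] Suc.IH
    by simp
  finally show ?case by (simp add: distrib_right)
qed

lemma integral_mult_increment:
  fixes f \<phi> :: "'a::euclidean_space \<Rightarrow> real"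
  assumes f_L2: "square_integrable lebesgue f" and \<phi>_L2: "square_integrable lebesgue \<phi>"
  shows "(\<integral>x. f x * (\<phi> (x + h) - \<phi> x) \<partial>lebesgue) = (\<integral>x. (f (x - h) - f x) * \<phi> x \<partial>lebesgue)"
proof -
  have integrable_mult: "integrable lebesgue (\<lambda>x. k x * l x)"
    if "square_integrable lebesgue k" "square_integrable lebesgue l" for k l :: "'a \<Rightarrow> real"
    using square_integrable_inner[OF that] by simp
  have shifted: "square_integrable lebesgue (\<lambda>x. f (x - h))"
    using square_integrable_shift[OF f_L2, of "- h"] by simp
  have "(\<integral>x. f x * \<phi> (x + h) \<partial>lebesgue) = (\<integral>x. f (x - h) * \<phi> x \<partial>lebesgue)"
    using integral_lebesgue_shift[of "\<lambda>x. f (x - h) * \<phi> x" h] integrable_mult[OF shifted \<phi>_L2]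
    by simp
  then show ?thesis
    using integrable_mult[OF f_L2 square_integrable_shift[OF \<phi>_L2]] integrable_mult[OF f_L2 \<phi>_L2]
      integrable_mult[OF shifted \<phi>_L2]
    by (simp add: left_diff_distrib right_diff_distrib)
qed

section \<open>Test functions\<close>

lemma iter_partial_Cons: "iter_partial (b # bs) f = partial b (iter_partial bs f)"
  by (simp add: partial_def)

lemma has_derivative_imp_line_DERIV:
  assumes "(f has_derivative D) (at (x + s *\<^sub>R b))"
  shows "((\<lambda>t. f (x + t *\<^sub>R b)) has_real_derivative D b) (at s)"
proof -
  have "((\<lambda>t. f (x + t *\<^sub>R b)) has_derivative (\<lambda>t. D (t *\<^sub>R b))) (at s)"
    by (rule has_derivative_compose[where f="\<lambda>t. x + t *\<^sub>R b" and g=f])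
       (auto intro!: derivative_eq_intros assms)
  moreover have "D (t *\<^sub>R b) = D b * t" for t
    using linear_cmul[OF has_derivative_linear[OF assms], of t b] by simp
  ultimately show ?thesis by (simp add: has_field_derivative_def)
qed

lemma has_derivative_imp_partial:
  assumes "(f has_derivative D) (at x)"
  shows "partial b f x = D b"
  using has_derivative_imp_line_DERIV[of f D x 0 b] assms by (simp add: partial_def DERIV_imp_deriv)

lemma partial_line_DERIV:
  assumes "f differentiable (at (x + s *\<^sub>R b))"
  shows "((\<lambda>t. f (x + t *\<^sub>R b)) has_real_derivative partial b f (x + s *\<^sub>R b)) (at s)"
  using assms has_derivative_imp_line_DERIV has_derivative_imp_partial by (metis differentiable_def)

lemma partial_shift: "partial b (\<lambda>x. f (x + h)) = (\<lambda>x. partial b f (x + h))"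
  by (simp add: partial_def ac_simps)

lemma partial_lincomb:
  assumes "f differentiable (at x)" "g differentiable (at x)"
  shows "partial b (\<lambda>x. a * f x + c * g x) x = a * partial b f x + c * partial b g x"
proof -
  obtain D E where "(f has_derivative D) (at x)" "(g has_derivative E) (at x)"
    using assms by (auto simp: differentiable_def)
  moreover from this have "((\<lambda>x. a * f x + c * g x) has_derivative (\<lambda>h. a * D h + c * E h)) (at x)"
    by (intro derivative_intros)
  ultimately show ?thesis by (simp add: has_derivative_imp_partial)
qed

lemma smooth_fun_iter_partial_differentiable:
  "smooth_fun f \<Longrightarrow> set bs \<subseteq> Basis \<Longrightarrow> iter_partial bs f differentiable (at x)"
  by (simp add: smooth_fun_def differentiable_on_def)

lemma smooth_fun_differentiable: "smooth_fun f \<Longrightarrow> f differentiable (at x)"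
  using smooth_fun_iter_partial_differentiable[of f "[]"] by simp

lemma smooth_fun_partial:
  assumes "smooth_fun f" "b \<in> Basis"
  shows "smooth_fun (partial b f)"
proof -
  have "iter_partial bs (partial b f) = iter_partial (bs @ [b]) f" for bs
    by (induction bs) (simp_all add: partial_def)
  with assms show ?thesis by (simp add: smooth_fun_def)
qed

lemma smooth_fun_continuous: "smooth_fun f \<Longrightarrow> continuous_on UNIV f"
  by (simp add: differentiable_imp_continuous_on differentiable_on_def smooth_fun_differentiable)

lemma smooth_fun_shift:
  assumes "smooth_fun f"
  shows "smooth_fun (\<lambda>x. f (x + h))"
proof -
  have "iter_partial bs (\<lambda>x. f (x + h)) = (\<lambda>x. iter_partial bs f (x + h))" for bs
    by (induction bs) (simp_all add: iter_partial_Cons partial_shift del: iter_partial.simps(2))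
  moreover have "(\<lambda>x. iter_partial bs f (x + h)) differentiable (at x)" if "set bs \<subseteq> Basis" for bs x
    using differentiable_compose[of "iter_partial bs f" "\<lambda>x. x + h"]
      smooth_fun_iter_partial_differentiable[OF assms that] by simp
  ultimately show ?thesis by (simp add: smooth_fun_def differentiable_on_def)
qed

lemma iter_partial_lincomb:
  assumes "smooth_fun f" "smooth_fun g" "set bs \<subseteq> Basis"
  shows "iter_partial bs (\<lambda>x. a * f x + c * g x)
      = (\<lambda>x. a * iter_partial bs f x + c * iter_partial bs g x)"
  using assms(3)
proof (induction bs)
  case (Cons b bs)
  have "partial b (\<lambda>x. a * iter_partial bs f x + c * iter_partial bs g x) x
      = a * partial b (iter_partial bs f) x + c * partial b (iter_partial bs g) x" for x
    using Cons.prems assms(1,2)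
    by (intro partial_lincomb smooth_fun_iter_partial_differentiable) auto
  then show ?case
    using Cons by (simp add: iter_partial_Cons del: iter_partial.simps(2))
qed simp

lemma smooth_fun_lincomb:
  assumes "smooth_fun f" "smooth_fun g"
  shows "smooth_fun (\<lambda>x. a * f x + c * g x)"
  using assms
  by (simp add: smooth_fun_def[of "\<lambda>x. a * f x + c * g x"] iter_partial_lincomb
      differentiable_on_def smooth_fun_iter_partial_differentiable)

lemma test_fun_iff: "test_fun \<phi> \<longleftrightarrow> smooth_fun \<phi> \<and> bounded {x. \<phi> x \<noteq> 0}"
  by (simp add: test_fun_def compact_closure)

lemma test_fun_smooth: "test_fun \<phi> \<Longrightarrow> smooth_fun \<phi>"
  by (simp add: test_fun_def)

lemma test_fun_support:
  assumes "test_fun \<phi>"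
  obtains R where "\<And>x. norm x > R \<Longrightarrow> \<phi> x = 0"
proof -
  obtain R where "\<forall>x\<in>{x. \<phi> x \<noteq> 0}. norm x \<le> R"
    using assms by (auto simp: test_fun_iff bounded_iff)
  then show ?thesis by (intro that[of R]) force
qed

lemma test_fun_shift:
  assumes "test_fun \<phi>"
  shows "test_fun (\<lambda>x. \<phi> (x + h))"
proof -
  have "bounded ((\<lambda>x. x - h) ` {x. \<phi> x \<noteq> 0})"
    using assms bounded_translation_minus[of "{x. \<phi> x \<noteq> 0}" h] by (simp add: test_fun_iff)
  moreover have "{x. \<phi> (x + h) \<noteq> 0} \<subseteq> (\<lambda>x. x - h) ` {x. \<phi> x \<noteq> 0}"
    by (force simp: image_iff)
  ultimately show ?thesis
    using assms bounded_subset by (auto simp: test_fun_iff smooth_fun_shift)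
qed

lemma test_fun_lincomb:
  assumes "test_fun \<phi>" "test_fun \<psi>"
  shows "test_fun (\<lambda>x. a * \<phi> x + c * \<psi> x)"
proof -
  have "{x. a * \<phi> x + c * \<psi> x \<noteq> 0} \<subseteq> {x. \<phi> x \<noteq> 0} \<union> {x. \<psi> x \<noteq> 0}" by auto
  then show ?thesis
    using assms bounded_subset[OF bounded_Un[THEN iffD2]]
    by (auto simp: test_fun_iff smooth_fun_lincomb)
qed

lemma test_fun_partial:
  fixes \<phi> :: "'a::euclidean_space \<Rightarrow> real"
  assumes "test_fun \<phi>" "b \<in> Basis"
  shows "test_fun (partial b \<phi>)"
proof -
  obtain R where R_support: "\<And>x. norm x > R \<Longrightarrow> \<phi> x = 0" using test_fun_support[OF assms(1)] by metis
  have "partial b \<phi> x = 0" if "norm x > R" for x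
  proof -
    have "open {x::'a. norm x > R}" by (intro open_Collect_less continuous_intros)
    then have "(\<phi> has_derivative (\<lambda>_. 0)) (at x)"
      by (rule has_derivative_transform_within_open[OF has_derivative_const[of 0]])
        (use that R_support in auto)
    then show ?thesis by (rule has_derivative_imp_partial)
  qed
  then have "{x. partial b \<phi> x \<noteq> 0} \<subseteq> cball 0 R" by (force simp: not_less[symmetric])
  then show ?thesis
    using assms bounded_subset[OF bounded_cball] by (auto simp: test_fun_iff smooth_fun_partial)
qed

lemma test_fun_bounded:
  assumes "test_fun \<phi>"
  obtains B where "B > 0" "\<And>x. \<bar>\<phi> x\<bar> \<le> B"
proof -
  have "bounded (\<phi> ` closure {x. \<phi> x \<noteq> 0})"
    using assms unfolding test_fun_def
    by (meson compact_continuous_image compact_imp_bounded continuous_on_subset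
      smooth_fun_continuous subset_UNIV)
  then obtain B where "B > 0" "\<And>x. x \<in> closure {x. \<phi> x \<noteq> 0} \<Longrightarrow> \<bar>\<phi> x\<bar> \<le> B"
    by (auto simp: bounded_pos)
  then have "\<bar>\<phi> x\<bar> \<le> B" for x
    using closure_subset[of "{x. \<phi> x \<noteq> 0}"] by (cases "\<phi> x = 0") auto
  with \<open>B > 0\<close> show ?thesis by (rule that)
qed

lemma continuous_imp_borel_measurable_lebesgue:
  "continuous_on UNIV f \<Longrightarrow> f \<in> borel_measurable lebesgue"
  by (intro measurable_completion) (simp add: borel_measurable_continuous_onI)

lemma test_fun_measurable [measurable_dest]:
  "test_fun \<phi> \<Longrightarrow> \<phi> \<in> borel_measurable lebesgue"
  by (simp add: continuous_imp_borel_measurable_lebesgue smooth_fun_continuous test_fun_smooth)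

lemma compact_imp_integrable_indicator:
  "compact K \<Longrightarrow> integrable lebesgue (indicator K :: 'a::euclidean_space \<Rightarrow> real)"
  using lmeasurable_compact by (intro integrable_real_indicator) (auto simp: fmeasurable_def)

lemma test_fun_powr_integrable:
  assumes "test_fun \<phi>" and "p \<ge> 0"
  shows "integrable lebesgue (\<lambda>x. \<bar>\<phi> x\<bar> powr p)"
proof -
  obtain B where B_bound: "\<And>x. \<bar>\<phi> x\<bar> \<le> B" using test_fun_bounded[OF assms(1)] by metis
  define K where "K = closure {x. \<phi> x \<noteq> 0}"
  have outside: "\<phi> x = 0" if "x \<notin> K" for x
    using that closure_subset[of "{x. \<phi> x \<noteq> 0}"] by (auto simp: K_def)
  have "integrable lebesgue (\<lambda>x. B powr p * indicator K x)"
    using assms(1)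
    by (intro integrable_mult_right compact_imp_integrable_indicator) (simp add: K_def test_fun_def)
  then show ?thesis
  proof (rule Bochner_Integration.integrable_bound)
    have "\<bar>\<phi> x\<bar> powr p \<le> B powr p * indicator K x" for x
      using powr_mono2[OF \<open>p \<ge> 0\<close> abs_ge_zero B_bound] outside by (cases "x \<in> K") auto
    then show "AE x in lebesgue. norm (\<bar>\<phi> x\<bar> powr p) \<le> norm (B powr p * indicator K x)" by simp
  qed (intro powr_real_measurable borel_measurable_abs borel_measurable_const
      test_fun_measurable assms)
qed

lemma test_fun_square_integrable: "test_fun \<phi> \<Longrightarrow> square_integrable lebesgue \<phi>"
  using test_fun_powr_integrable[of \<phi> 2] by (simp add: square_integrable_def test_fun_measurable)

lemma grad_fun_inner: "b \<in> Basis \<Longrightarrow> grad_fun f x \<bullet> b = partial b f x"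
  by (simp add: grad_fun_def)

lemma grad_fun_shift: "grad_fun (\<lambda>x. f (x + h)) = (\<lambda>x. grad_fun f (x + h))"
  by (simp add: grad_fun_def partial_shift)

lemma grad_fun_lincomb:
  assumes "smooth_fun f" "smooth_fun g"
  shows "grad_fun (\<lambda>x. a * f x + c * g x) x = a *\<^sub>R grad_fun f x + c *\<^sub>R grad_fun g x"
  using assms
  by (simp add: grad_fun_def partial_lincomb smooth_fun_differentiable scaleR_add_left sum.distrib
    scaleR_sum_right)

lemma grad_fun_square_integrable: "test_fun \<phi> \<Longrightarrow> square_integrable lebesgue (grad_fun \<phi>)"
  by (rule square_integrable_euclideanI)
    (simp add: grad_fun_inner test_fun_square_integrable test_fun_partial)

subsection \<open>Bump functions\<close>

definition flat :: "real poly \<Rightarrow> real \<Rightarrow> real" where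
  "flat p x = (if x > 0 then poly p (1 / x) * exp (- (1 / x)) else 0)"

lemma poly_times_exp_tendsto_0:
  "((\<lambda>y::real. poly q y * exp (- y)) \<longlongrightarrow> 0) at_top"
proof -
  have "((\<lambda>y::real. \<Sum>i\<le>degree q. coeff q i * (y ^ i / exp y))
      \<longlongrightarrow> (\<Sum>i\<le>degree q. coeff q i * 0)) at_top"
    by (intro tendsto_intros tendsto_power_div_exp_0)
  then show ?thesis
    by (simp add: poly_altdef sum_distrib_right exp_minus divide_inverse mult.assoc)
qed

lemma flat_DERIV_zero: "(flat p has_real_derivative 0) (at 0)"
proof -
  have "((\<lambda>x. poly (pCons 0 p) (inverse x) * exp (- inverse x)) \<longlongrightarrow> 0) (at_right 0)"
    by (rule filterlim_compose[OF poly_times_exp_tendsto_0 filterlim_inverse_at_top_right])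
  then have "((\<lambda>h. (flat p (0 + h) - flat p 0) / h) \<longlongrightarrow> 0) (at_right 0)"
    by (rule Lim_transform_eventually)
       (auto simp: eventually_at_right_less flat_def field_simps
         intro!: eventually_at_rightI[of 0 1])
  moreover have "((\<lambda>h. (flat p (0 + h) - flat p 0) / h) \<longlongrightarrow> 0) (at_left 0)"
    by (rule Lim_transform_eventually[OF tendsto_const])
       (auto simp: flat_def intro!: eventually_at_leftI[of "-1" 0])
  ultimately show ?thesis
    by (simp add: DERIV_def filterlim_split_at)
qed

lemma flat_DERIV: "(flat p has_real_derivative flat ([:0, 0, 1:] * (p - pderiv p)) x) (at x)"
proof -
  consider (positive) "x > 0" | (negative) "x < 0" | (zero) "x = 0" by linarith
  then show ?thesis
  proof cases
    case positive
    then have "((\<lambda>x. poly p (1 / x) * exp (- (1 / x))) has_real_derivative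
        flat ([:0, 0, 1:] * (p - pderiv p)) x) (at x)"
      by (auto intro!: derivative_eq_intros simp: flat_def field_simps power2_eq_square)
    then show ?thesis
      by (rule has_field_derivative_transform_within_open[of _ _ _ "{0<..}"])
         (use positive in \<open>auto simp: flat_def\<close>)
  next
    case negative
    have "(flat p has_real_derivative 0) (at x)"
      by (rule has_field_derivative_transform_within_open[OF DERIV_const[of 0], of "{..<0}"])
         (use negative in \<open>auto simp: flat_def\<close>)
    then show ?thesis using negative by (simp add: flat_def)
  next
    case zero
    then show ?thesis using flat_DERIV_zero by (simp add: flat_def)
  qed
qed

inductive flat_algebra :: "('a::euclidean_space \<Rightarrow> real) \<Rightarrow> bool" where
  flat: "flat_algebra (\<lambda>x. flat p (c \<bullet> x + d))"
| const: "flat_algebra (\<lambda>x. k)"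
| add: "flat_algebra f \<Longrightarrow> flat_algebra g \<Longrightarrow> flat_algebra (\<lambda>x. f x + g x)"
| mult: "flat_algebra f \<Longrightarrow> flat_algebra g \<Longrightarrow> flat_algebra (\<lambda>x. f x * g x)"

lemma flat_algebra_derivative:
  "flat_algebra f \<Longrightarrow> \<exists>D. (\<forall>x. (f has_derivative (\<lambda>h. D h x)) (at x)) \<and> (\<forall>h. flat_algebra (D h))"
proof (induction rule: flat_algebra.induct)
  case (flat p c d)
  let ?D = "\<lambda>h x. (c \<bullet> h) * flat ([:0, 0, 1:] * (p - pderiv p)) (c \<bullet> x + d)"
  have "((\<lambda>x. c \<bullet> x + d) has_derivative (\<lambda>h. c \<bullet> h)) (at x)" for x
    by (auto intro!: derivative_eq_intros)
  from has_derivative_compose[OF this has_field_derivative_imp_has_derivative[OF flat_DERIV]]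
  have "((\<lambda>x. flat p (c \<bullet> x + d)) has_derivative (\<lambda>h. ?D h x)) (at x)" for x
    by (simp add: mult.commute)
  moreover have "flat_algebra (?D h)" for h
    by (intro flat_algebra.intros)
  ultimately show ?case by (intro exI[of _ ?D]) blast
next
  case (const k)
  show ?case by (intro exI[of _ "\<lambda>h x. 0"]) (auto intro: flat_algebra.intros)
next
  case (add f g)
  then obtain D E where "\<forall>x. (f has_derivative (\<lambda>h. D h x)) (at x)" "\<forall>h. flat_algebra (D h)"
    "\<forall>x. (g has_derivative (\<lambda>h. E h x)) (at x)" "\<forall>h. flat_algebra (E h)" by blast
  then show ?case
    by (intro exI[of _ "\<lambda>h x. D h x + E h x"]) (auto intro!: flat_algebra.intros has_derivative_add)
next
  case (mult f g)
  then obtain D E where "\<forall>x. (f has_derivative (\<lambda>h. D h x)) (at x)" "\<forall>h. flat_algebra (D h)"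
    "\<forall>x. (g has_derivative (\<lambda>h. E h x)) (at x)" "\<forall>h. flat_algebra (E h)" by blast
  with mult.hyps show ?case
    by (intro exI[of _ "\<lambda>h x. f x * E h x + D h x * g x"])
      (auto intro!: flat_algebra.intros has_derivative_mult)
qed

lemma flat_algebra_partial:
  assumes "flat_algebra f"
  shows "flat_algebra (partial b f)"
proof -
  obtain D where D_derivative: "\<And>x. (f has_derivative (\<lambda>h. D h x)) (at x)" and "flat_algebra (D b)"
    using flat_algebra_derivative[OF assms] by blast
  moreover have "partial b f = D b"
    by (simp add: fun_eq_iff has_derivative_imp_partial[OF D_derivative])
  ultimately show ?thesis by simp
qed

lemma flat_algebra_smooth:
  assumes "flat_algebra f"
  shows "smooth_fun f"
proof -
  have "flat_algebra (iter_partial bs f)" for bs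
    by (induction bs)
      (simp_all add: iter_partial_Cons assms flat_algebra_partial del: iter_partial.simps(2))
  then show ?thesis
    unfolding smooth_fun_def differentiable_on_def differentiable_def
    by (metis (no_types) flat_algebra_derivative)
qed

lemma flat_algebra_prod:
  "finite I \<Longrightarrow> (\<And>i. i \<in> I \<Longrightarrow> flat_algebra (f i)) \<Longrightarrow> flat_algebra (\<lambda>x. \<Prod>i\<in>I. f i x)"
  by (induction I rule: finite_induct) (auto intro: flat_algebra.intros)

definition box_bump :: "'a::euclidean_space \<Rightarrow> 'a \<Rightarrow> nat \<Rightarrow> 'a \<Rightarrow> real" where
  "box_bump a c n x =
    (\<Prod>b\<in>Basis. flat 1 (real (Suc n) * (x \<bullet> b - a \<bullet> b)) * flat 1 (real (Suc n) * (c \<bullet> b - x \<bullet> b)))"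

lemma flat_1_bounds: "0 \<le> flat 1 x" "flat 1 x \<le> 1"
  by (auto simp: flat_def)

lemma box_bump_bounds: "0 \<le> box_bump a c n x" "box_bump a c n x \<le> 1"
  unfolding box_bump_def
  by (auto intro!: prod_nonneg prod_le_1 mult_le_one simp: flat_1_bounds)

lemma box_bump_outside:
  assumes "x \<notin> box a c"
  shows "box_bump a c n x = 0"
proof -
  obtain b where b_Basis: "b \<in> Basis" "x \<bullet> b - a \<bullet> b \<le> 0 \<or> c \<bullet> b - x \<bullet> b \<le> 0"
    using assms by (force simp: mem_box)
  have "flat 1 (real (Suc n) * y) = 0" if "y \<le> 0" for y
    using that by (auto simp: flat_def zero_less_mult_iff simp del: of_nat_Suc)
  then show ?thesis
    unfolding box_bump_def using b_Basis
    by (intro prod_zero bexI[of _ b]) (auto simp del: of_nat_Suc)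
qed

lemma box_bump_tendsto:
  "(\<lambda>n. box_bump a c n x) \<longlonglongrightarrow> indicator (box a c) x"
proof (cases "x \<in> box a c")
  case False
  then show ?thesis by (simp add: box_bump_outside)
next
  case True
  have lim: "(\<lambda>n. flat 1 (real (Suc n) * y)) \<longlonglongrightarrow> 1" if "y > 0" for y
  proof -
    have "(\<lambda>n. exp (- ((1 / y) * inverse (real (Suc n))))) \<longlonglongrightarrow> exp (- ((1 / y) * 0))"
      by (intro tendsto_intros LIMSEQ_inverse_real_of_nat)
    moreover have "flat 1 (real (Suc n) * y) = exp (- ((1 / y) * inverse (real (Suc n))))" for n
      using that by (auto simp: flat_def divide_inverse mult_ac)
    ultimately show ?thesis by simp
  qed
  have "(\<lambda>n. box_bump a c n x) \<longlonglongrightarrow> (\<Prod>b\<in>(Basis::'a set). 1 * 1)"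
    unfolding box_bump_def
    by (intro tendsto_prod tendsto_mult lim) (use True in \<open>auto simp: mem_box\<close>)
  then show ?thesis using True by simp
qed

lemma box_bump_test_fun: "test_fun (box_bump a c n)"
proof -
  have "flat_algebra (\<lambda>x. flat 1 (real (Suc n) * (x \<bullet> b - a \<bullet> b))
      * flat 1 (real (Suc n) * (c \<bullet> b - x \<bullet> b)))" for b :: 'a
  proof -
    have "flat_algebra (\<lambda>x. flat 1 ((real (Suc n) *\<^sub>R b) \<bullet> x + (- real (Suc n) * (a \<bullet> b)))
        * flat 1 ((- real (Suc n) *\<^sub>R b) \<bullet> x + real (Suc n) * (c \<bullet> b)))"
      by (intro flat_algebra.intros)
    then show ?thesis by (simp add: algebra_simps inner_commute)
  qed
  then have "flat_algebra (box_bump a c n)"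
    unfolding box_bump_def[abs_def] by (intro flat_algebra_prod) auto
  moreover have "{x. box_bump a c n x \<noteq> 0} \<subseteq> box a c"
    using box_bump_outside by blast
  ultimately show ?thesis
    unfolding test_fun_iff using flat_algebra_smooth bounded_subset bounded_box by blast
qed

lemma test_fun_zero: "test_fun (\<lambda>_. 0)"
  using flat_algebra_smooth[OF flat_algebra.const[of 0]] by (simp add: test_fun_iff)

section \<open>Weak derivatives\<close>

subsection \<open>Locally integrable functions\<close>

lemma L1_loc_measurable [measurable_dest]: "L1_loc f \<Longrightarrow> f \<in> borel_measurable lebesgue"
  by (simp add: L1_loc_def)

lemma L1_loc_mult_test_fun_integrable:
  assumes [measurable]: "L1_loc f" "test_fun \<phi>"
  shows "integrable lebesgue (\<lambda>x. f x * \<phi> x)"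
proof -
  obtain B where B_bound: "B > 0" "\<And>x. \<bar>\<phi> x\<bar> \<le> B" using test_fun_bounded[OF assms(2)] by metis
  define K where "K = closure {x. \<phi> x \<noteq> 0}"
  have "compact K" using assms(2) by (simp add: K_def test_fun_def)
  then have "integrable lebesgue (\<lambda>x. B * (indicator K x *\<^sub>R f x))"
    using assms(1) unfolding L1_loc_def set_integrable_def by (intro integrable_mult_right) auto
  then show ?thesis
  proof (rule Bochner_Integration.integrable_bound)
    have "\<bar>f x * \<phi> x\<bar> \<le> \<bar>B * (indicator K x *\<^sub>R f x)\<bar>" for x
    proof (cases "\<phi> x = 0")
      case False
      then have "x \<in> K" unfolding K_def by (simp add: closure_subset[THEN subsetD])
      then show ?thesis
        using B_bound(1) mult_right_mono[OF B_bound(2)[of x], of "\<bar>f x\<bar>"]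
        by (simp add: abs_mult mult.commute)
    qed simp
    then show "AE x in lebesgue. norm (f x * \<phi> x) \<le> norm (B * (indicator K x *\<^sub>R f x))" by simp
  qed measurable
qed

lemma L1_loc_shift:
  fixes f :: "'a::euclidean_space \<Rightarrow> real"
  assumes "L1_loc f"
  shows "L1_loc (\<lambda>x. f (x + h))"
  unfolding L1_loc_def
proof (intro conjI allI impI)
  show "(\<lambda>x. f (x + h)) \<in> borel_measurable lebesgue"
    by (intro borel_measurable_lebesgue_shift L1_loc_measurable assms)
  fix K :: "'a set" assume "compact K"
  then have "compact ((\<lambda>x. x + h) ` K)"
    by (intro compact_continuous_image continuous_intros)
  then have "integrable lebesgue (\<lambda>x. indicator ((\<lambda>x. x + h) ` K) x *\<^sub>R f x)"
    using assms by (auto simp: L1_loc_def set_integrable_def)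
  from integrable_lebesgue_shift[OF this, of h]
  show "set_integrable lebesgue K (\<lambda>x. f (x + h))"
    by (simp add: set_integrable_def indicator_def image_iff)
qed

lemma L1_loc_lincomb:
  fixes f g :: "'a::euclidean_space \<Rightarrow> real"
  assumes [measurable]: "L1_loc f" "L1_loc g"
  shows "L1_loc (\<lambda>x. a * f x + c * g x)"
  unfolding L1_loc_def
proof (intro conjI allI impI)
  fix K :: "'a set" assume "compact K"
  then show "set_integrable lebesgue K (\<lambda>x. a * f x + c * g x)"
    using assms by (intro set_integral_add(1) set_integrable_mult_right) (auto simp: L1_loc_def)
qed measurable

lemma square_integrable_imp_L1_loc:
  fixes f :: "'a::euclidean_space \<Rightarrow> real"
  assumes "square_integrable lebesgue f"
  shows "L1_loc f"
  unfolding L1_loc_def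
proof (intro conjI allI impI)
  fix K :: "'a set" assume "compact K"
  then have "integrable lebesgue (indicator K :: 'a \<Rightarrow> real)"
    by (rule compact_imp_integrable_indicator)
  moreover have "(norm (indicator K x :: real))\<^sup>2 = indicator K x" for x
    by (simp add: indicator_def)
  ultimately have "square_integrable lebesgue (indicator K :: 'a \<Rightarrow> real)"
    by (auto simp: square_integrable_def)
  from square_integrable_inner[OF this assms] show "set_integrable lebesgue K f"
    by (simp add: set_integrable_def)
qed (use assms in \<open>simp add: square_integrable_measurable\<close>)

lemma square_integrable_imp_L2_loc:
  assumes "square_integrable lebesgue f"
  shows "L2_loc f"
  unfolding L2_loc_def set_integrable_def
proof (intro conjI allI impI integrable_mult_indicator)
  show "integrable lebesgue (\<lambda>x. (f x)\<^sup>2)"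
    using square_integrable_integrable_norm_power2[OF assms] by simp
qed (simp_all add: borel_compact square_integrable_measurable assms)

lemma continuous_imp_L2_loc:
  fixes u :: "'a::euclidean_space \<Rightarrow> real"
  assumes "continuous_on UNIV u"
  shows "L2_loc u"
  unfolding L2_loc_def
proof (intro conjI allI impI)
  show "u \<in> borel_measurable lebesgue" by (rule continuous_imp_borel_measurable_lebesgue[OF assms])
  fix K :: "'a set" assume "compact K"
  then have "integrable lborel (\<lambda>x. indicator K x *\<^sub>R (u x)\<^sup>2)"
    by (rule borel_integrable_compact)
      (intro continuous_intros continuous_on_subset[OF assms], simp)
  then show "set_integrable lebesgue K (\<lambda>x. (u x)\<^sup>2)"
    unfolding set_integrable_def by (simp add: integrable_completion borel_measurable_integrable)
qed

subsection \<open>The fundamental lemma of the calculus of variations\<close>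

lemma integral_box_bump_tendsto:
  assumes "L1_loc f"
  shows "(\<lambda>n. \<integral>x. f x * box_bump a c n x \<partial>lebesgue) \<longlonglongrightarrow> (\<integral>x. f x * indicator (box a c) x \<partial>lebesgue)"
proof (rule integral_dominated_convergence)
  have "set_integrable lebesgue (cbox a c) f"
    using assms by (simp add: L1_loc_def)
  then show "integrable lebesgue (\<lambda>x. norm (indicator (cbox a c) x *\<^sub>R f x))"
    unfolding set_integrable_def by (rule integrable_norm)
  show "AE x in lebesgue. (\<lambda>n. f x * box_bump a c n x) \<longlonglongrightarrow> f x * indicator (box a c) x"
    by (intro AE_I2 tendsto_mult tendsto_const box_bump_tendsto)
  have "norm (f x * box_bump a c n x) \<le> norm (indicator (cbox a c) x *\<^sub>R f x)" for n x
    using box_bump_bounds[of a c n x] box_bump_outside[of x a c n] box_subset_cbox[of a c]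
    by (cases "x \<in> box a c") (auto simp: abs_mult mult_left_le)
  then show "AE x in lebesgue. norm (f x * box_bump a c n x)
      \<le> norm (indicator (cbox a c) x *\<^sub>R f x)" for n
    by simp
  show "(\<lambda>x. f x * box_bump a c n x) \<in> borel_measurable lebesgue" for n
    by (intro borel_measurable_integrable L1_loc_mult_test_fun_integrable assms box_bump_test_fun)
  show "(\<lambda>x. f x * indicator (box a c) x) \<in> borel_measurable lebesgue"
    by (intro borel_measurable_times borel_measurable_indicator L1_loc_measurable assms) simp
qed

lemma AE_eq_0_if_box_integrals_eq_0:
  fixes f :: "'a::euclidean_space \<Rightarrow> 'b::euclidean_space"
  assumes "\<And>a c. f integrable_on cbox a c" and box_integral: "\<And>a c. integral (cbox a c) f = 0"
  shows "AE x in lebesgue. f x = 0"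
proof -
  obtain N where "negligible N" and N_differentiation: "\<And>x e. \<lbrakk>x \<notin> N; 0 < e\<rbrakk> \<Longrightarrow>
      \<exists>d>0. \<forall>h. 0 < h \<and> h < d \<longrightarrow>
        norm (integral (cbox x (x + h *\<^sub>R One)) f /\<^sub>R h ^ DIM('a) - f x) < e"
    using integrable_ccontinuous_explicit[of f] assms(1) by blast
  have "f x = 0" if x_regular: "x \<notin> N" for x
  proof (rule ccontr)
    assume "f x \<noteq> 0"
    then obtain d where "d > 0" and d_close: "\<forall>h. 0 < h \<and> h < d \<longrightarrow>
        norm (integral (cbox x (x + h *\<^sub>R One)) f /\<^sub>R h ^ DIM('a) - f x) < norm (f x)"
      using N_differentiation[OF x_regular, of "norm (f x)"] by auto
    with d_close[rule_format, of "d/2"] show False by (simp add: box_integral)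
  qed
  then show ?thesis
    using \<open>negligible N\<close> by (intro AE_I'[of N]) (auto simp: negligible_iff_null_sets)
qed

theorem fundamental_lemma_calculus_of_variations:
  assumes f_L1_loc: "L1_loc f" and test: "\<And>\<phi>. test_fun \<phi> \<Longrightarrow> (\<integral>x. f x * \<phi> x \<partial>lebesgue) = 0"
  shows "AE x in lebesgue. f x = 0"
proof (rule AE_eq_0_if_box_integrals_eq_0)
  fix a c
  have cbox_integrable: "set_integrable lebesgue (cbox a c) f"
    using f_L1_loc by (simp add: L1_loc_def)
  then show "f integrable_on cbox a c"
    by (rule set_lebesgue_integral_eq_integral(1))
  have "(\<integral>x. f x * indicator (box a c) x \<partial>lebesgue) = 0"
    using integral_box_bump_tendsto[OF f_L1_loc, of a c] test[OF box_bump_test_fun]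
    by (simp add: LIMSEQ_const_iff)
  moreover have "set_integrable lebesgue (box a c) f"
    by (rule set_integrable_subset[OF cbox_integrable]) (auto simp: box_subset_cbox)
  ultimately have "integral (box a c) f = 0"
    using set_lebesgue_integral_eq_integral(2)[of "box a c" f]
    by (simp add: set_lebesgue_integral_def mult.commute)
  then show "integral (cbox a c) f = 0" by (simp add: integral_open_interval)
qed

subsection \<open>Weak partial derivatives and weak gradients\<close>

definition has_weak_partial :: "'a::euclidean_space \<Rightarrow> ('a \<Rightarrow> real) \<Rightarrow> ('a \<Rightarrow> real) \<Rightarrow> bool" where
  "has_weak_partial b u v \<longleftrightarrow> L1_loc u \<and> L1_loc v \<and>
    (\<forall>\<phi>. test_fun \<phi> \<longrightarrow> (\<integral>x. u x * partial b \<phi> x \<partial>lebesgue) = - (\<integral>x. v x * \<phi> x \<partial>lebesgue))"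

lemma has_weak_partialD:
  assumes "has_weak_partial b u v"
  shows "L1_loc u" "L1_loc v"
    and "test_fun \<phi> \<Longrightarrow> (\<integral>x. u x * partial b \<phi> x \<partial>lebesgue) = - (\<integral>x. v x * \<phi> x \<partial>lebesgue)"
  using assms by (auto simp: has_weak_partial_def)

lemma has_weak_gradient_iff:
  fixes g :: "'a::euclidean_space \<Rightarrow> 'a"
  shows "has_weak_gradient u g \<longleftrightarrow> (\<forall>b\<in>Basis. has_weak_partial b u (\<lambda>x. g x \<bullet> b))"
  using nonempty_Basis[where 'a='a] unfolding has_weak_gradient_def has_weak_partial_def by blast

lemma has_weak_partial_unique:
  assumes "has_weak_partial b u v" "has_weak_partial b u w"
  shows "AE x in lebesgue. v x = w x"
proof -
  note weak = has_weak_partialD[OF assms(1)] has_weak_partialD[OF assms(2)]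
  have "AE x in lebesgue. 1 * v x + (-1) * w x = 0"
  proof (rule fundamental_lemma_calculus_of_variations)
    show "L1_loc (\<lambda>x. 1 * v x + (-1) * w x)"
      by (intro L1_loc_lincomb weak)
    fix \<phi> :: "'a \<Rightarrow> real" assume \<phi>_test: "test_fun \<phi>"
    then have "(\<integral>x. v x * \<phi> x \<partial>lebesgue) = (\<integral>x. w x * \<phi> x \<partial>lebesgue)"
      using weak(3,6) by simp
    then show "(\<integral>x. (1 * v x + (-1) * w x) * \<phi> x \<partial>lebesgue) = 0"
      using L1_loc_mult_test_fun_integrable[OF weak(2) \<phi>_test]
        L1_loc_mult_test_fun_integrable[OF weak(5) \<phi>_test]
      by (simp add: left_diff_distrib)
  qed
  then show ?thesis by simp
qed

lemma has_weak_partial_shift: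
  fixes u v :: "'a::euclidean_space \<Rightarrow> real"
  assumes "b \<in> Basis" "has_weak_partial b u v"
  shows "has_weak_partial b (\<lambda>x. u (x + h)) (\<lambda>x. v (x + h))"
  unfolding has_weak_partial_def
proof (intro conjI allI impI)
  note weak = has_weak_partialD[OF assms(2)]
  show "L1_loc (\<lambda>x. u (x + h))" "L1_loc (\<lambda>x. v (x + h))"
    by (intro L1_loc_shift weak)+
  fix \<phi> :: "'a \<Rightarrow> real" assume \<phi>_test: "test_fun \<phi>"
  define \<psi> where "\<psi> x = \<phi> (x + (- h))" for x
  have \<psi>_test: "test_fun \<psi>" unfolding \<psi>_def[abs_def] by (rule test_fun_shift[OF \<phi>_test])
  have "partial b \<phi> x = partial b \<psi> (x + h)" for x
    unfolding \<psi>_def[abs_def] partial_shift by simp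
  then have "(\<integral>x. u (x + h) * partial b \<phi> x \<partial>lebesgue) = (\<integral>x. u x * partial b \<psi> x \<partial>lebesgue)"
    using integral_lebesgue_shift[of "\<lambda>x. u x * partial b \<psi> x"]
      L1_loc_mult_test_fun_integrable[OF weak(1) test_fun_partial[OF \<psi>_test assms(1)]] by simp
  also have "\<dots> = - (\<integral>x. v x * \<psi> x \<partial>lebesgue)"
    by (rule weak(3)[OF \<psi>_test])
  also have "(\<integral>x. v x * \<psi> x \<partial>lebesgue) = (\<integral>x. v (x + h) * \<phi> x \<partial>lebesgue)"
    using integral_lebesgue_shift[of "\<lambda>x. v x * \<psi> x" h]
      L1_loc_mult_test_fun_integrable[OF weak(2) \<psi>_test]
    by (simp add: \<psi>_def)
  finally show "(\<integral>x. u (x + h) * partial b \<phi> x \<partial>lebesgue) = - (\<integral>x. v (x + h) * \<phi> x \<partial>lebesgue)" .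
qed

lemma has_weak_partial_lincomb:
  assumes "b \<in> Basis" "has_weak_partial b u v" "has_weak_partial b u' v'"
  shows "has_weak_partial b (\<lambda>x. a * u x + c * u' x) (\<lambda>x. a * v x + c * v' x)"
  unfolding has_weak_partial_def
proof (intro conjI allI impI)
  note weak = has_weak_partialD[OF assms(2)] and weak' = has_weak_partialD[OF assms(3)]
  show "L1_loc (\<lambda>x. a * u x + c * u' x)" "L1_loc (\<lambda>x. a * v x + c * v' x)"
    by (intro L1_loc_lincomb weak weak')+
  fix \<phi> :: "'a \<Rightarrow> real" assume \<phi>_test: "test_fun \<phi>"
  have integral_lincomb: "(\<integral>x. (a * f x + c * f' x) * \<psi> x \<partial>lebesgue)
      = a * (\<integral>x. f x * \<psi> x \<partial>lebesgue) + c * (\<integral>x. f' x * \<psi> x \<partial>lebesgue)"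
    if "L1_loc f" "L1_loc f'" "test_fun \<psi>" for f f' \<psi> :: "'a \<Rightarrow> real"
    using L1_loc_mult_test_fun_integrable[OF that(1,3)]
      L1_loc_mult_test_fun_integrable[OF that(2,3)]
    by (simp add: distrib_right mult.assoc)
  show "(\<integral>x. (a * u x + c * u' x) * partial b \<phi> x \<partial>lebesgue)
      = - (\<integral>x. (a * v x + c * v' x) * \<phi> x \<partial>lebesgue)"
    using integral_lincomb[OF weak(1) weak'(1) test_fun_partial[OF \<phi>_test assms(1)]]
      integral_lincomb[OF weak(2) weak'(2) \<phi>_test] weak(3)[OF \<phi>_test] weak'(3)[OF \<phi>_test] by simp
qed

lemma has_weak_gradient_measurable:
  assumes "has_weak_gradient u g"
  shows "u \<in> borel_measurable lebesgue" "g \<in> borel_measurable lebesgue"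
  using assms unfolding has_weak_gradient_def L1_loc_def borel_measurable_euclidean_space[of g]
  by blast+

lemma has_weak_gradient_unique:
  fixes g k :: "'a::euclidean_space \<Rightarrow> 'a"
  assumes "has_weak_gradient u g" "has_weak_gradient u k"
  shows "AE x in lebesgue. g x = k x"
proof -
  have "AE x in lebesgue. \<forall>b\<in>Basis. g x \<bullet> b = k x \<bullet> b"
    using assms
    by (intro AE_finite_allI) (auto simp: has_weak_gradient_iff intro: has_weak_partial_unique)
  then show ?thesis by eventually_elim (auto intro: euclidean_eqI)
qed

lemma has_weak_gradient_weak_grad:
  "has_weak_gradient u g \<Longrightarrow> has_weak_gradient u (weak_grad u)"
  unfolding weak_grad_def by (rule someI[of "has_weak_gradient u"])

lemma has_weak_gradient_shift:
  "has_weak_gradient u g \<Longrightarrow> has_weak_gradient (\<lambda>x. u (x + h)) (\<lambda>x. g (x + h))"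
  by (auto simp: has_weak_gradient_iff intro: has_weak_partial_shift[where v="\<lambda>x. g x \<bullet> b" for b])

lemma has_weak_gradient_lincomb:
  assumes "has_weak_gradient u g" "has_weak_gradient v k"
  shows "has_weak_gradient (\<lambda>x. a * u x + c * v x) (\<lambda>x. a *\<^sub>R g x + c *\<^sub>R k x)"
  using assms by (simp add: has_weak_gradient_iff has_weak_partial_lincomb inner_add_left)

section \<open>Difference quotients\<close>

lemma test_fun_line_DERIV:
  "test_fun \<phi> \<Longrightarrow> ((\<lambda>t. \<phi> (x + t *\<^sub>R b)) has_real_derivative partial b \<phi> (x + s *\<^sub>R b)) (at s)"
  by (intro partial_line_DERIV smooth_fun_differentiable test_fun_smooth)

lemma test_fun_increment_le:
  assumes \<phi>_test: "test_fun \<phi>" and bound: "\<And>x. \<bar>partial b \<phi> x\<bar> \<le> B"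
  shows "\<bar>\<phi> (x + t *\<^sub>R b) - \<phi> x\<bar> \<le> B * \<bar>t\<bar>"
  using field_differentiable_bound[of UNIV "\<lambda>s. \<phi> (x + s *\<^sub>R b)"
      "\<lambda>s. partial b \<phi> (x + s *\<^sub>R b)" B t 0]
    test_fun_line_DERIV[OF \<phi>_test] bound
  by simp

lemma test_fun_quotient_tendsto:
  assumes \<phi>_test: "test_fun \<phi>" and s_null: "s \<longlonglongrightarrow> 0" "\<And>n. s n \<noteq> 0"
  shows "(\<lambda>n. (\<phi> (x + s n *\<^sub>R b) - \<phi> x) / s n) \<longlonglongrightarrow> partial b \<phi> x"
proof -
  have "((\<lambda>h. (\<phi> (x + h *\<^sub>R b) - \<phi> x) / h) \<longlongrightarrow> partial b \<phi> x) (at 0)"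
    using test_fun_line_DERIV[OF \<phi>_test, of x b 0] by (simp add: DERIV_def)
  moreover have "filterlim s (at 0) sequentially"
    using s_null by (simp add: filterlim_at)
  ultimately show ?thesis by (rule filterlim_compose)
qed

lemma test_fun_quotient_square_integrable:
  fixes \<phi> :: "'a::euclidean_space \<Rightarrow> real"
  assumes "test_fun \<phi>"
  shows "square_integrable lebesgue (\<lambda>x. (\<phi> (x + h) - \<phi> x) / t)"
proof -
  have "square_integrable lebesgue (\<lambda>x. \<phi> (x + h) - \<phi> x)"
    by (intro square_integrable_increment test_fun_square_integrable assms)
  from square_integrable_mult_right[OF this, of "1 / t"] show ?thesis by simp
qed

lemma test_fun_quotient_error_bound:
  fixes \<phi> :: "'a::euclidean_space \<Rightarrow> real"
  assumes \<phi>_test: "test_fun \<phi>" and b_Basis: "b \<in> Basis"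
  obtains B R where "\<And>t x. t \<noteq> 0 \<Longrightarrow> \<bar>t\<bar> \<le> T \<Longrightarrow>
    \<bar>(\<phi> (x + t *\<^sub>R b) - \<phi> x) / t - partial b \<phi> x\<bar> \<le> B * indicator (cball 0 R) x"
proof -
  note partial_test = test_fun_partial[OF \<phi>_test b_Basis]
  obtain B where B_bound: "B > 0" "\<And>x. \<bar>partial b \<phi> x\<bar> \<le> B"
    using test_fun_bounded[OF partial_test] by metis
  obtain R where R_support: "\<And>x. norm x > R \<Longrightarrow> \<phi> x = 0" using test_fun_support[OF \<phi>_test] by metis
  obtain R' where R'_support: "\<And>x. norm x > R' \<Longrightarrow> partial b \<phi> x = 0"
    using test_fun_support[OF partial_test] by metis
  have "\<bar>(\<phi> (x + t *\<^sub>R b) - \<phi> x) / t - partial b \<phi> x\<bar>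
      \<le> 2 * B * indicator (cball 0 (max (R + T) R')) x"
    if t_bounds: "t \<noteq> 0" "\<bar>t\<bar> \<le> T" for t x
  proof (cases "norm x \<le> max (R + T) R'")
    case True
    have "\<bar>(\<phi> (x + t *\<^sub>R b) - \<phi> x) / t\<bar> \<le> B"
      using test_fun_increment_le[OF \<phi>_test B_bound(2), of x t] t_bounds by (simp add: divide_le_eq)
    with B_bound(2)[of x] have "\<bar>(\<phi> (x + t *\<^sub>R b) - \<phi> x) / t - partial b \<phi> x\<bar> \<le> 2 * B" by linarith
    with True show ?thesis by simp
  next
    case False
    moreover have "norm x \<le> norm (x + t *\<^sub>R b) + \<bar>t\<bar>"
      using norm_triangle_ineq4[of "x + t *\<^sub>R b" "t *\<^sub>R b"] b_Basis by simp
    ultimately have "\<phi> (x + t *\<^sub>R b) = 0" "\<phi> x = 0" "partial b \<phi> x = 0"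
      using t_bounds by (auto intro!: R_support R'_support)
    then show ?thesis using B_bound(1) by simp
  qed
  then show ?thesis by (rule that)
qed

lemma test_fun_quotient_L2_tendsto:
  fixes \<phi> :: "'a::euclidean_space \<Rightarrow> real"
  assumes \<phi>_test: "test_fun \<phi>" and b_Basis: "b \<in> Basis" and s_null: "s \<longlonglongrightarrow> 0" "\<And>n. s n \<noteq> 0"
  shows "(\<lambda>n. L2_norm lebesgue (\<lambda>x. (\<phi> (x + s n *\<^sub>R b) - \<phi> x) / s n - partial b \<phi> x)) \<longlonglongrightarrow> 0"
proof -
  define err where "err n x = (\<phi> (x + s n *\<^sub>R b) - \<phi> x) / s n - partial b \<phi> x" for n x
  have err_L2: "square_integrable lebesgue (err n)" for n
    unfolding err_def
    by (intro square_integrable_diff test_fun_quotient_square_integrable test_fun_square_integrable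
      test_fun_partial \<phi>_test b_Basis)
  obtain T where T_bound: "\<And>n. \<bar>s n\<bar> \<le> T"
    using convergent_imp_Bseq[OF convergentI[OF s_null(1)]] by (auto simp: Bseq_def)
  obtain B R where "\<And>t x. t \<noteq> 0 \<Longrightarrow> \<bar>t\<bar> \<le> T \<Longrightarrow>
      \<bar>(\<phi> (x + t *\<^sub>R b) - \<phi> x) / t - partial b \<phi> x\<bar> \<le> B * indicator (cball 0 R) x"
    using test_fun_quotient_error_bound[OF \<phi>_test b_Basis] by metis
  then have bound: "\<bar>err n x\<bar> \<le> B * indicator (cball 0 R) x" for n x
    using s_null(2) T_bound by (simp add: err_def)
  have "(\<lambda>n. \<integral>x. (norm (err n x))\<^sup>2 \<partial>lebesgue) \<longlonglongrightarrow> (\<integral>x. 0 \<partial>(lebesgue :: 'a measure))"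
  proof (rule integral_dominated_convergence)
    show "integrable lebesgue (\<lambda>x::'a. B\<^sup>2 * indicator (cball 0 R) x)"
      by (intro integrable_mult_right compact_imp_integrable_indicator) simp
    have "(\<lambda>n. (norm (err n x))\<^sup>2) \<longlonglongrightarrow> (norm (partial b \<phi> x - partial b \<phi> x))\<^sup>2" for x
      unfolding err_def by (intro tendsto_intros test_fun_quotient_tendsto \<phi>_test s_null)
    then show "AE x in lebesgue. (\<lambda>n. (norm (err n x))\<^sup>2) \<longlonglongrightarrow> 0" by simp
    have "(err n x)\<^sup>2 \<le> B\<^sup>2 * indicator (cball 0 R) x" for n x
      using power_mono[OF bound abs_ge_zero, of n x 2] by (cases "x \<in> cball 0 R") auto
    then show "AE x in lebesgue. norm ((norm (err n x))\<^sup>2) \<le> B\<^sup>2 * indicator (cball 0 R) x" for n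
      by simp
    show "(\<lambda>x. (norm (err n x))\<^sup>2) \<in> borel_measurable lebesgue" for n
      by (intro borel_measurable_integrable square_integrable_integrable_norm_power2 err_L2)
  qed simp
  then have "(\<lambda>n. L2_norm lebesgue (err n)) \<longlonglongrightarrow> 0"
    unfolding L2_norm_def using tendsto_real_sqrt by fastforce
  then show ?thesis by (simp add: err_def[abs_def])
qed

text \<open>Splitting the increment into \<open>n\<close> equal ones reduces the estimate to the limit of difference
  quotients.\<close>

lemma test_fun_increment_L2_le:
  fixes \<phi> :: "'a::euclidean_space \<Rightarrow> real"
  assumes \<phi>_test: "test_fun \<phi>" and b_Basis: "b \<in> Basis"
  shows "L2_norm lebesgue (\<lambda>x. \<phi> (x + t *\<^sub>R b) - \<phi> x) \<le> \<bar>t\<bar> * L2_norm lebesgue (partial b \<phi>)"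
proof (cases "t = 0")
  case True
  then show ?thesis by (simp add: L2_norm_def)
next
  case False
  define s where "s n = t * inverse (real (Suc n))" for n
  have s_null: "s \<longlonglongrightarrow> 0" "\<And>n. s n \<noteq> 0"
    unfolding s_def[abs_def]
    using tendsto_mult_right_zero[OF LIMSEQ_inverse_real_of_nat, of t] False by auto
  define quot where "quot n x = (\<phi> (x + s n *\<^sub>R b) - \<phi> x) / s n" for n x
  have "L2_norm lebesgue (\<lambda>x. \<phi> (x + t *\<^sub>R b) - \<phi> x) \<le> \<bar>t\<bar> * L2_norm lebesgue (quot n)" for n
  proof -
    have "real (Suc n) *\<^sub>R s n *\<^sub>R b = t *\<^sub>R b" by (simp add: s_def)
    then have "L2_norm lebesgue (\<lambda>x. \<phi> (x + t *\<^sub>R b) - \<phi> x)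
        \<le> real (Suc n) * L2_norm lebesgue (\<lambda>x. \<phi> (x + s n *\<^sub>R b) - \<phi> x)"
      using L2_norm_increment_of_nat_mult[OF test_fun_square_integrable[OF \<phi>_test],
          of "Suc n" "s n *\<^sub>R b"]
      by (simp only:)
    also have "(\<lambda>x. \<phi> (x + s n *\<^sub>R b) - \<phi> x) = (\<lambda>x. s n * quot n x)"
      using s_null(2) by (simp add: quot_def)
    also have "real (Suc n) * L2_norm lebesgue \<dots> = \<bar>real (Suc n) * s n\<bar> * L2_norm lebesgue (quot n)"
      by (simp add: L2_norm_mult_right abs_mult)
    also have "real (Suc n) * s n = t" by (simp add: s_def)
    finally show ?thesis .
  qed
  moreover have "(\<lambda>n. \<bar>t\<bar> * L2_norm lebesgue (quot n)) \<longlonglongrightarrow> \<bar>t\<bar> * L2_norm lebesgue (partial b \<phi>)"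
    unfolding quot_def
    by (intro tendsto_mult_left L2_norm_tendsto test_fun_quotient_L2_tendsto
        test_fun_quotient_square_integrable test_fun_square_integrable test_fun_partial
        \<phi>_test b_Basis s_null)
  ultimately show ?thesis by (intro LIMSEQ_le_const) auto
qed

lemma bounded_increments_imp_bounded_pairing:
  fixes f \<phi> :: "'a::euclidean_space \<Rightarrow> real"
  assumes f_L2: "square_integrable lebesgue f" and b_Basis: "b \<in> Basis" and \<phi>_test: "test_fun \<phi>"
    and bound: "\<And>t. L2_norm lebesgue (\<lambda>x. f (x + t *\<^sub>R b) - f x) \<le> C * \<bar>t\<bar>"
  shows "\<bar>\<integral>x. f x * partial b \<phi> x \<partial>lebesgue\<bar> \<le> C * L2_norm lebesgue \<phi>"
proof (rule LIMSEQ_le_const2)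
  define s where "s n = inverse (real (Suc n))" for n
  have s_null: "s \<longlonglongrightarrow> 0" "s n > 0" for n
    unfolding s_def[abs_def] using LIMSEQ_inverse_real_of_nat by auto
  define quot where "quot n x = (\<phi> (x + s n *\<^sub>R b) - \<phi> x) / s n" for n x
  note \<phi>_L2 = test_fun_square_integrable[OF \<phi>_test]
  have "(\<lambda>n. \<integral>x. quot n x \<bullet> f x \<partial>lebesgue) \<longlonglongrightarrow> (\<integral>x. partial b \<phi> x \<bullet> f x \<partial>lebesgue)"
    unfolding quot_def using s_null
    by (intro L2_inner_tendsto test_fun_quotient_L2_tendsto test_fun_quotient_square_integrable
        test_fun_square_integrable test_fun_partial \<phi>_test b_Basis f_L2)
       (auto simp: less_imp_neq[symmetric])
  then show "(\<lambda>n. \<bar>\<integral>x. f x * quot n x \<partial>lebesgue\<bar>) \<longlonglongrightarrow> \<bar>\<integral>x. f x * partial b \<phi> x \<partial>lebesgue\<bar>"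
    by (intro tendsto_rabs) (simp add: mult.commute)
  have "\<bar>\<integral>x. f x * quot n x \<partial>lebesgue\<bar> \<le> C * L2_norm lebesgue \<phi>" for n
  proof -
    have "s n * \<bar>\<integral>x. f x * quot n x \<partial>lebesgue\<bar> = \<bar>\<integral>x. f x * (\<phi> (x + s n *\<^sub>R b) - \<phi> x) \<partial>lebesgue\<bar>"
      using s_null(2)[of n] by (simp add: quot_def)
    also have "\<dots> = \<bar>\<integral>x. (f (x - s n *\<^sub>R b) - f x) * \<phi> x \<partial>lebesgue\<bar>"
      by (simp only: integral_mult_increment[OF f_L2 \<phi>_L2])
    also have "\<dots> \<le> L2_norm lebesgue (\<lambda>x. f (x - s n *\<^sub>R b) - f x) * L2_norm lebesgue \<phi>"
      using L2_Cauchy_Schwarz[OF square_integrable_increment[OF f_L2, of "- s n *\<^sub>R b"] \<phi>_L2]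
      by simp
    also have "\<dots> \<le> s n * (C * L2_norm lebesgue \<phi>)"
      using mult_right_mono[OF bound[of "- s n"] L2_norm_nonneg] s_null(2)[of n]
      by (simp add: mult_ac)
    finally show ?thesis using s_null(2)[of n] by simp
  qed
  then show "\<exists>N. \<forall>n\<ge>N. \<bar>\<integral>x. f x * quot n x \<partial>lebesgue\<bar> \<le> C * L2_norm lebesgue \<phi>" by blast
qed

theorem has_weak_partial_of_bounded_increments:
  fixes f :: "'a::euclidean_space \<Rightarrow> real"
  assumes f_L2: "square_integrable lebesgue f" and b_Basis: "b \<in> Basis"
    and bound: "\<And>t. L2_norm lebesgue (\<lambda>x. f (x + t *\<^sub>R b) - f x) \<le> C * \<bar>t\<bar>"
  obtains v where "square_integrable lebesgue v" "has_weak_partial b f v"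
proof -
  define T where "T \<phi> = - (\<integral>x. f x * partial b \<phi> x \<partial>lebesgue)" for \<phi>
  interpret bounded_L2_functional lebesgue "Collect test_fun" T C
  proof
    show "Collect test_fun \<noteq> ({} :: ('a \<Rightarrow> real) set)" using test_fun_zero by blast
    fix \<phi> :: "'a \<Rightarrow> real" assume "\<phi> \<in> Collect test_fun"
    then have \<phi>_test: "test_fun \<phi>" by simp
    then show "square_integrable lebesgue \<phi>" by (rule test_fun_square_integrable)
    show "\<bar>T \<phi>\<bar> \<le> C * L2_norm lebesgue \<phi>"
      unfolding T_def using bounded_increments_imp_bounded_pairing[OF f_L2 b_Basis \<phi>_test bound]
      by simp
    fix \<psi> :: "'a \<Rightarrow> real" and a c :: real assume "\<psi> \<in> Collect test_fun"
    then have \<psi>_test: "test_fun \<psi>" by simp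
    show "(\<lambda>x. a *\<^sub>R \<phi> x + c *\<^sub>R \<psi> x) \<in> Collect test_fun"
      using test_fun_lincomb[OF \<phi>_test \<psi>_test] by simp
    have "partial b (\<lambda>x. a * \<phi> x + c * \<psi> x) x = a * partial b \<phi> x + c * partial b \<psi> x" for x
      by (intro partial_lincomb smooth_fun_differentiable test_fun_smooth \<phi>_test \<psi>_test)
    moreover have "integrable lebesgue (\<lambda>x. f x * partial b \<theta> x)"
      if "test_fun \<theta>" for \<theta> :: "'a \<Rightarrow> real"
      by (intro L1_loc_mult_test_fun_integrable square_integrable_imp_L1_loc test_fun_partial
          f_L2 b_Basis that)
    ultimately show "T (\<lambda>x. a *\<^sub>R \<phi> x + c *\<^sub>R \<psi> x) = a * T \<phi> + c * T \<psi>"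
      using \<phi>_test \<psi>_test by (simp add: T_def distrib_left mult.left_commute[of "f _"])
  qed
  obtain v where v_L2: "square_integrable lebesgue v"
    and "\<And>\<phi>. test_fun \<phi> \<Longrightarrow> (\<integral>x. v x \<bullet> \<phi> x \<partial>lebesgue) = T \<phi>"
    using Riesz_representation by auto
  then have "has_weak_partial b f v"
    by (simp add: has_weak_partial_def square_integrable_imp_L1_loc f_L2 T_def)
  with v_L2 show ?thesis by (rule that)
qed

lemma has_weak_gradient_of_bounded_increments:
  fixes f :: "'a::euclidean_space \<Rightarrow> real"
  assumes f_L2: "square_integrable lebesgue f"
    and bound: "\<And>b t. b \<in> Basis \<Longrightarrow> L2_norm lebesgue (\<lambda>x. f (x + t *\<^sub>R b) - f x) \<le> C * \<bar>t\<bar>"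
  obtains g where "square_integrable lebesgue g" "has_weak_gradient f g"
proof -
  have "\<forall>b\<in>Basis. \<exists>v. square_integrable lebesgue v \<and> has_weak_partial b f v"
    using has_weak_partial_of_bounded_increments[OF f_L2 _ bound] by metis
  then obtain v where
    v_partial: "\<And>b. b \<in> Basis \<Longrightarrow> square_integrable lebesgue (v b) \<and> has_weak_partial b f (v b)"
    by metis
  define g where "g x = (\<Sum>b\<in>Basis. v b x *\<^sub>R b)" for x
  have component: "(\<lambda>x. g x \<bullet> b) = v b" if "b \<in> Basis" for b
    using that by (simp add: g_def)
  have "square_integrable lebesgue g"
    by (rule square_integrable_euclideanI) (simp add: component v_partial)
  moreover have "has_weak_gradient f g"
    using v_partial by (simp add: has_weak_gradient_iff component)
  ultimately show ?thesis by (rule that)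
qed

theorem W22_loc_of_bounded_gradient_increments:
  fixes u :: "'a::euclidean_space \<Rightarrow> real"
  assumes u_L2_loc: "L2_loc u" and grad: "has_weak_gradient u g"
    and g_L2: "square_integrable lebesgue g"
    and bound: "\<And>b t. b \<in> Basis \<Longrightarrow> L2_norm lebesgue (\<lambda>x. g (x + t *\<^sub>R b) - g x) \<le> C * \<bar>t\<bar>"
  shows "W22_loc u"
proof -
  have hessian: "\<exists>h. has_weak_gradient (\<lambda>x. g x \<bullet> c) h \<and> (\<forall>b\<in>Basis. L2_loc (\<lambda>x. h x \<bullet> b))"
    if c_Basis: "c \<in> Basis" for c
  proof -
    note component_L2 = square_integrable_component[OF g_L2 c_Basis]
    have component_bound: "L2_norm lebesgue (\<lambda>x. g (x + t *\<^sub>R b) \<bullet> c - g x \<bullet> c) \<le> C * \<bar>t\<bar>"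
      if b_Basis: "b \<in> Basis" for b t
    proof -
      have "norm (g (x + t *\<^sub>R b) \<bullet> c - g x \<bullet> c) \<le> norm (g (x + t *\<^sub>R b) - g x)" for x
        using Basis_le_norm[OF c_Basis, of "g (x + t *\<^sub>R b) - g x"] by (simp add: inner_diff_left)
      from L2_norm_mono[OF square_integrable_increment[OF component_L2]
        square_integrable_increment[OF g_L2] this]
      show ?thesis using bound[OF b_Basis, of t] by simp
    qed
    obtain h where "square_integrable lebesgue h" "has_weak_gradient (\<lambda>x. g x \<bullet> c) h"
      by (rule has_weak_gradient_of_bounded_increments[OF component_L2 component_bound])
    then show ?thesis using square_integrable_imp_L2_loc[OF square_integrable_component] by blast
  qed
  show ?thesis
    unfolding W22_loc_def
    by (intro conjI exI[of _ g] ballI u_L2_loc grad hessian square_integrable_imp_L2_loc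
      square_integrable_component[OF g_L2])
qed

section \<open>Lebesgue spaces and the energy space\<close>

lemma Lp_measurable [measurable_dest]: "Lp p f \<Longrightarrow> f \<in> borel_measurable lebesgue"
  by (simp add: Lp_def)

lemma Lp_2_iff: "Lp 2 f \<longleftrightarrow> square_integrable lebesgue f"
  by (simp add: Lp_def square_integrable_def)

lemma test_fun_Lp: "test_fun \<phi> \<Longrightarrow> p \<ge> 0 \<Longrightarrow> Lp p \<phi>"
  by (simp add: Lp_def test_fun_measurable test_fun_powr_integrable)

lemma Lp_shift: "Lp p f \<Longrightarrow> Lp p (\<lambda>x. f (x + h))"
  unfolding Lp_def
  using integrable_lebesgue_shift[of "\<lambda>x. \<bar>f x\<bar> powr p" h]
  by (auto intro: borel_measurable_lebesgue_shift)

lemma Lp_bound: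
  assumes dominating: "integrable lebesgue k"
    and f_measurable [measurable]: "f \<in> borel_measurable lebesgue"
    and bound: "\<And>x. \<bar>f x\<bar> powr p \<le> k x"
  shows "Lp p f"
  unfolding Lp_def
proof
  show "integrable lebesgue (\<lambda>x. \<bar>f x\<bar> powr p)"
  proof (rule Bochner_Integration.integrable_bound[OF dominating])
    show "(\<lambda>x. \<bar>f x\<bar> powr p) \<in> borel_measurable lebesgue"
      by (intro powr_real_measurable borel_measurable_abs borel_measurable_const f_measurable)
    show "AE x in lebesgue. norm (\<bar>f x\<bar> powr p) \<le> norm (k x)"
      using bound by (intro AE_I2) (simp add: order_trans[OF _ abs_ge_self])
  qed
qed (fact f_measurable)

lemma Lp_interpolate:
  assumes "Lp m f" "Lp q f" "m \<le> r" "r \<le> q"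
  shows "Lp r f"
proof (rule Lp_bound)
  show "integrable lebesgue (\<lambda>x. \<bar>f x\<bar> powr m + \<bar>f x\<bar> powr q)"
    using assms by (simp add: Lp_def)
  show "f \<in> borel_measurable lebesgue" using assms by (simp add: Lp_def)
  show "\<bar>f x\<bar> powr r \<le> \<bar>f x\<bar> powr m + \<bar>f x\<bar> powr q" for x
  proof (cases "\<bar>f x\<bar> \<le> 1")
    case True
    then have "\<bar>f x\<bar> powr r \<le> \<bar>f x\<bar> powr m" using assms by (intro powr_mono') auto
    then show ?thesis by (simp add: add_increasing2)
  next
    case False
    then have "\<bar>f x\<bar> powr r \<le> \<bar>f x\<bar> powr q" using assms by (intro powr_mono) auto
    then show ?thesis by (simp add: add_increasing)
  qed
qed

lemma Lp_mult_integrable: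
  assumes [measurable]: "Lp p f" "Lp r g" and conjugate: "p > 1" "r > 1" "1 / p + 1 / r = 1"
  shows "integrable lebesgue (\<lambda>x. f x * g x)"
proof (rule Bochner_Integration.integrable_bound)
  show "integrable lebesgue (\<lambda>x. \<bar>f x\<bar> powr p / p + \<bar>g x\<bar> powr r / r)"
    using assms by (simp add: Lp_def)
  show "AE x in lebesgue. norm (f x * g x) \<le> norm (\<bar>f x\<bar> powr p / p + \<bar>g x\<bar> powr r / r)"
    using Youngs_inequality[OF conjugate]
    by (intro AE_I2) (auto simp: abs_mult intro: order_trans[OF _ abs_ge_self])
qed measurable

lemma powr_abs_lincomb_le:
  fixes p :: real
  assumes "p \<ge> 0"
  shows "\<bar>a * x + c * y\<bar> powr p \<le> 2 powr p * (\<bar>a\<bar> powr p * \<bar>x\<bar> powr p + \<bar>c\<bar> powr p * \<bar>y\<bar> powr p)"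
proof -
  have "\<bar>a * x + c * y\<bar> \<le> 2 * max \<bar>a * x\<bar> \<bar>c * y\<bar>" by linarith
  then have "\<bar>a * x + c * y\<bar> powr p \<le> (2 * max \<bar>a * x\<bar> \<bar>c * y\<bar>) powr p"
    using assms by (intro powr_mono2) auto
  also have "\<dots> = 2 powr p * max \<bar>a * x\<bar> \<bar>c * y\<bar> powr p"
    by (rule powr_mult)
  also have "\<dots> \<le> 2 powr p * (\<bar>a * x\<bar> powr p + \<bar>c * y\<bar> powr p)"
    by (intro mult_left_mono) (auto simp: max_def)
  finally show ?thesis by (simp add: abs_mult powr_mult)
qed

lemma Lp_lincomb:
  assumes "Lp p f" "Lp p g" "p \<ge> 0"
  shows "Lp p (\<lambda>x. a * f x + c * g x)"
    and "(\<integral>x. \<bar>a * f x + c * g x\<bar> powr p \<partial>lebesgue)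
      \<le> 2 powr p * (\<bar>a\<bar> powr p * (\<integral>x. \<bar>f x\<bar> powr p \<partial>lebesgue)
        + \<bar>c\<bar> powr p * (\<integral>x. \<bar>g x\<bar> powr p \<partial>lebesgue))"
proof -
  have f_Lp: "f \<in> borel_measurable lebesgue" "integrable lebesgue (\<lambda>x. \<bar>f x\<bar> powr p)"
    and g_Lp: "g \<in> borel_measurable lebesgue" "integrable lebesgue (\<lambda>x. \<bar>g x\<bar> powr p)"
    using assms by (auto simp: Lp_def)
  let ?k = "\<lambda>x. 2 powr p * (\<bar>a\<bar> powr p * \<bar>f x\<bar> powr p + \<bar>c\<bar> powr p * \<bar>g x\<bar> powr p)"
  have bound_integrable: "integrable lebesgue ?k"
    by (intro integrable_mult_right Bochner_Integration.integrable_add f_Lp g_Lp)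
  show lincomb: "Lp p (\<lambda>x. a * f x + c * g x)"
    by (rule Lp_bound[OF bound_integrable _ powr_abs_lincomb_le[OF assms(3)]])
       (intro borel_measurable_add borel_measurable_times borel_measurable_const f_Lp g_Lp)
  have "(\<integral>x. \<bar>a * f x + c * g x\<bar> powr p \<partial>lebesgue) \<le> (\<integral>x. ?k x \<partial>lebesgue)"
    using lincomb
    by (intro integral_mono bound_integrable powr_abs_lincomb_le assms(3)) (simp add: Lp_def)
  also have "\<dots> = 2 powr p * (\<bar>a\<bar> powr p * (\<integral>x. \<bar>f x\<bar> powr p \<partial>lebesgue)
      + \<bar>c\<bar> powr p * (\<integral>x. \<bar>g x\<bar> powr p \<partial>lebesgue))"
    using f_Lp g_Lp by simp
  finally show "(\<integral>x. \<bar>a * f x + c * g x\<bar> powr p \<partial>lebesgue)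
      \<le> 2 powr p * (\<bar>a\<bar> powr p * (\<integral>x. \<bar>f x\<bar> powr p \<partial>lebesgue)
        + \<bar>c\<bar> powr p * (\<integral>x. \<bar>g x\<bar> powr p \<partial>lebesgue))" .
qed

definition Lp_converges :: "real \<Rightarrow> (nat \<Rightarrow> 'a::euclidean_space \<Rightarrow> real) \<Rightarrow> ('a \<Rightarrow> real) \<Rightarrow> bool" where
  "Lp_converges p f u \<longleftrightarrow> (\<forall>k. Lp p (\<lambda>x. f k x - u x)) \<and>
    (\<lambda>k. \<integral>x. \<bar>f k x - u x\<bar> powr p \<partial>lebesgue) \<longlonglongrightarrow> 0"

lemma Lp_converges_shift:
  assumes "Lp_converges p f u"
  shows "Lp_converges p (\<lambda>k x. f k (x + h)) (\<lambda>x. u (x + h))"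
proof -
  have diff: "Lp p (\<lambda>x. f k x - u x)" for k using assms by (simp add: Lp_converges_def)
  have "(\<integral>x. \<bar>f k (x + h) - u (x + h)\<bar> powr p \<partial>lebesgue)
      = (\<integral>x. \<bar>f k x - u x\<bar> powr p \<partial>lebesgue)" for k
    using integral_lebesgue_shift[of "\<lambda>x. \<bar>f k x - u x\<bar> powr p" h] diff[of k] by (auto simp: Lp_def)
  then show ?thesis
    using assms Lp_shift[OF diff] by (simp add: Lp_converges_def)
qed

lemma Lp_converges_lincomb:
  assumes "Lp_converges p f u" "Lp_converges p g v" "p \<ge> 0"
  shows "Lp_converges p (\<lambda>k x. a * f k x + c * g k x) (\<lambda>x. a * u x + c * v x)"
proof -
  let ?I = "\<lambda>f u. \<integral>x. \<bar>f x - u x :: real\<bar> powr p \<partial>lebesgue"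
  have diff: "Lp p (\<lambda>x. f k x - u x)" "Lp p (\<lambda>x. g k x - v x)" for k
    using assms by (auto simp: Lp_converges_def)
  have "a * f k x + c * g k x - (a * u x + c * v x) = a * (f k x - u x) + c * (g k x - v x)" for k x
    by (simp add: algebra_simps)
  then have lincomb: "Lp p (\<lambda>x. a * f k x + c * g k x - (a * u x + c * v x))"
    "?I (\<lambda>x. a * f k x + c * g k x) (\<lambda>x. a * u x + c * v x)
      \<le> 2 powr p * (\<bar>a\<bar> powr p * ?I (f k) u + \<bar>c\<bar> powr p * ?I (g k) v)" for k
    using Lp_lincomb[OF diff[of k] \<open>p \<ge> 0\<close>, of a c] by (simp_all only:)
  have "(\<lambda>k. ?I (\<lambda>x. a * f k x + c * g k x) (\<lambda>x. a * u x + c * v x)) \<longlonglongrightarrow> 0"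
  proof (rule tendsto_sandwich[OF _ _ tendsto_const])
    show "\<forall>\<^sub>F k in sequentially. ?I (\<lambda>x. a * f k x + c * g k x) (\<lambda>x. a * u x + c * v x)
        \<le> 2 powr p * (\<bar>a\<bar> powr p * ?I (f k) u + \<bar>c\<bar> powr p * ?I (g k) v)"
      by (intro always_eventually allI lincomb(2))
    have "(\<lambda>k. 2 powr p * (\<bar>a\<bar> powr p * ?I (f k) u + \<bar>c\<bar> powr p * ?I (g k) v))
        \<longlonglongrightarrow> 2 powr p * (\<bar>a\<bar> powr p * 0 + \<bar>c\<bar> powr p * 0)"
      using assms unfolding Lp_converges_def by (intro tendsto_intros) auto
    then show "(\<lambda>k. 2 powr p * (\<bar>a\<bar> powr p * ?I (f k) u + \<bar>c\<bar> powr p * ?I (g k) v)) \<longlonglongrightarrow> 0" by simp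
  qed auto
  then show ?thesis by (simp add: Lp_converges_def lincomb(1))
qed

lemma Lp_converges_limit:
  assumes "Lp_converges p f u" "Lp p (f 0)" "p \<ge> 0"
  shows "Lp p u"
  using Lp_lincomb(1)[of p "f 0" "\<lambda>x. f 0 x - u x" 1 "-1"] assms by (simp add: Lp_converges_def)

lemma Lp_converges_AE_subseq:
  assumes "Lp_converges p f u" "p > 0"
  obtains r where "strict_mono r" "AE x in lebesgue. (\<lambda>n. f (r n) x) \<longlonglongrightarrow> u x"
proof -
  obtain r where r_mono: "strict_mono r" and "AE x in lebesgue. (\<lambda>n. \<bar>f (r n) x - u x\<bar> powr p) \<longlonglongrightarrow> 0"
    using tendsto_L1_AE_subseq[of lebesgue "\<lambda>k x. \<bar>f k x - u x\<bar> powr p"] assms(1)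
    by (auto simp: Lp_converges_def Lp_def)
  from this(2) have "AE x in lebesgue. (\<lambda>n. f (r n) x) \<longlonglongrightarrow> u x"
  proof eventually_elim
    case (elim x)
    have "(\<lambda>n. (\<bar>f (r n) x - u x\<bar> powr p) powr (1 / p)) \<longlonglongrightarrow> 0 powr (1 / p)"
      using \<open>p > 0\<close> by (intro tendsto_powr2[OF elim tendsto_const]) auto
    then have "(\<lambda>n. \<bar>f (r n) x - u x\<bar>) \<longlonglongrightarrow> 0"
      using \<open>p > 0\<close> by (simp add: powr_powr)
    then show ?case by (simp add: tendsto_rabs_zero_iff LIM_zero_iff)
  qed
  with r_mono show ?thesis by (rule that)
qed

subsection \<open>The energy space\<close>

definition has_D12_gradient :: "('a::euclidean_space \<Rightarrow> real) \<Rightarrow> ('a \<Rightarrow> 'a) \<Rightarrow> bool" where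
  "has_D12_gradient u g \<longleftrightarrow> has_weak_gradient u g \<and> square_integrable lebesgue g \<and>
    (\<exists>\<phi>. (\<forall>k. test_fun (\<phi> k)) \<and> (\<lambda>k. L2_norm lebesgue (\<lambda>x. grad_fun (\<phi> k) x - g x)) \<longlonglongrightarrow> 0 \<and>
      Lp_converges (crit_exp TYPE('a)) \<phi> u)"

lemma has_D12_gradientD:
  assumes "has_D12_gradient u g"
  shows "has_weak_gradient u g" "square_integrable lebesgue g"
  using assms by (auto simp: has_D12_gradient_def)

lemma has_D12_gradientE:
  fixes u :: "'a::euclidean_space \<Rightarrow> real"
  assumes "has_D12_gradient u g"
  obtains \<phi> where "\<And>k. test_fun (\<phi> k)" "(\<lambda>k. L2_norm lebesgue (\<lambda>x. grad_fun (\<phi> k) x - g x)) \<longlonglongrightarrow> 0"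
    "Lp_converges (crit_exp TYPE('a)) \<phi> u"
  using assms by (auto simp: has_D12_gradient_def)

lemma D12_iff: "D12 u \<longleftrightarrow> (\<exists>g. has_D12_gradient u g)"
proof -
  have approx_iff: "(\<lambda>k. \<integral>x. (norm (grad_fun (\<phi> k) x - g x))\<^sup>2 \<partial>lebesgue) \<longlonglongrightarrow> 0 \<and>
        (\<forall>k. integrable lebesgue (\<lambda>x. (norm (grad_fun (\<phi> k) x - g x))\<^sup>2)) \<and>
        (\<forall>k. integrable lebesgue (\<lambda>x. \<bar>\<phi> k x - u x\<bar> powr crit_exp TYPE('a))) \<and>
        (\<lambda>k. \<integral>x. \<bar>\<phi> k x - u x\<bar> powr crit_exp TYPE('a) \<partial>lebesgue) \<longlonglongrightarrow> 0
      \<longleftrightarrow> (\<lambda>k. L2_norm lebesgue (\<lambda>x. grad_fun (\<phi> k) x - g x)) \<longlonglongrightarrow> 0 \<and>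
        Lp_converges (crit_exp TYPE('a)) \<phi> u"
    if grad: "has_weak_gradient u g" and g_L2: "square_integrable lebesgue g"
      and \<phi>_test: "\<forall>k. test_fun (\<phi> k)" for g \<phi>
  proof -
    have "integrable lebesgue (\<lambda>x. (norm (grad_fun (\<phi> k) x - g x))\<^sup>2)" for k
      using \<phi>_test
      by (intro square_integrable_integrable_norm_power2 square_integrable_diff
          grad_fun_square_integrable g_L2) simp
    moreover have "(\<lambda>k. \<integral>x. (norm (grad_fun (\<phi> k) x - g x))\<^sup>2 \<partial>lebesgue) \<longlonglongrightarrow> 0
        \<longleftrightarrow> (\<lambda>k. L2_norm lebesgue (\<lambda>x. grad_fun (\<phi> k) x - g x)) \<longlonglongrightarrow> 0"
      using tendsto_real_sqrt[of _ 0] tendsto_power[of _ 0 _ 2]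
      by (auto simp: L2_norm_power2[symmetric] L2_norm_nonneg)
    moreover have "(\<lambda>x. \<phi> k x - u x) \<in> borel_measurable lebesgue" for k
      using \<phi>_test
      by (intro borel_measurable_diff test_fun_measurable
          has_weak_gradient_measurable(1)[OF grad]) simp
    ultimately show ?thesis by (auto simp: Lp_converges_def Lp_def)
  qed
  have norm_iff: "Lp 2 (\<lambda>x. norm (g x)) \<longleftrightarrow> square_integrable lebesgue g"
    if "has_weak_gradient u g" for g
    using has_weak_gradient_measurable(2)[OF that] by (simp add: Lp_def square_integrable_def)
  show ?thesis
    unfolding D12_def has_D12_gradient_def
    by (intro iff_exI conj_cong[OF refl] conj_cong[OF norm_iff] approx_iff)
qed

lemma crit_exp_gt_1: "DIM('a::euclidean_space) \<ge> 3 \<Longrightarrow> crit_exp TYPE('a) > 1"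
  by (simp add: crit_exp_def less_divide_eq)

lemma has_D12_gradient_shift:
  fixes u :: "'a::euclidean_space \<Rightarrow> real"
  assumes "has_D12_gradient u g"
  shows "has_D12_gradient (\<lambda>x. u (x + h)) (\<lambda>x. g (x + h))"
proof -
  note g_props = has_D12_gradientD[OF assms]
  obtain \<phi> where \<phi>_approx: "\<And>k. test_fun (\<phi> k)"
    "(\<lambda>k. L2_norm lebesgue (\<lambda>x. grad_fun (\<phi> k) x - g x)) \<longlonglongrightarrow> 0"
    "Lp_converges (crit_exp TYPE('a)) \<phi> u"
    by (rule has_D12_gradientE[OF assms]) blast
  have "square_integrable lebesgue (\<lambda>x. grad_fun (\<phi> k) x - g x)" for k
    by (intro square_integrable_diff grad_fun_square_integrable \<phi>_approx g_props)
  from L2_norm_shift[OF this]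
  have "L2_norm lebesgue (\<lambda>x. grad_fun (\<phi> k) (x + h) - g (x + h))
      = L2_norm lebesgue (\<lambda>x. grad_fun (\<phi> k) x - g x)" for k .
  with \<phi>_approx(2) have "(\<lambda>k. L2_norm lebesgue (\<lambda>x. grad_fun (\<lambda>x. \<phi> k (x + h)) x - g (x + h))) \<longlonglongrightarrow> 0"
    by (simp add: grad_fun_shift)
  moreover note test_fun_shift[OF \<phi>_approx(1)] Lp_converges_shift[OF \<phi>_approx(3)]
  ultimately show ?thesis
    unfolding has_D12_gradient_def
    by (intro conjI exI[of _ "\<lambda>k x. \<phi> k (x + h)"] allI has_weak_gradient_shift
      square_integrable_shift g_props)
qed

lemma has_D12_gradient_lincomb:
  fixes u v :: "'a::euclidean_space \<Rightarrow> real"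
  assumes "DIM('a) \<ge> 3" and u_D12: "has_D12_gradient u g" and v_D12: "has_D12_gradient v k"
  shows "has_D12_gradient (\<lambda>x. a * u x + c * v x) (\<lambda>x. a *\<^sub>R g x + c *\<^sub>R k x)"
proof -
  note g_props = has_D12_gradientD[OF u_D12] and k_props = has_D12_gradientD[OF v_D12]
  obtain \<phi> where \<phi>_approx: "\<And>n. test_fun (\<phi> n)"
    "(\<lambda>n. L2_norm lebesgue (\<lambda>x. grad_fun (\<phi> n) x - g x)) \<longlonglongrightarrow> 0"
    "Lp_converges (crit_exp TYPE('a)) \<phi> u"
    by (rule has_D12_gradientE[OF u_D12]) blast
  obtain \<psi> where \<psi>_approx: "\<And>n. test_fun (\<psi> n)"
    "(\<lambda>n. L2_norm lebesgue (\<lambda>x. grad_fun (\<psi> n) x - k x)) \<longlonglongrightarrow> 0"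
    "Lp_converges (crit_exp TYPE('a)) \<psi> v"
    by (rule has_D12_gradientE[OF v_D12]) blast
  define \<theta> where "\<theta> n x = a * \<phi> n x + c * \<psi> n x" for n x
  have "grad_fun (\<theta> n) x = a *\<^sub>R grad_fun (\<phi> n) x + c *\<^sub>R grad_fun (\<psi> n) x" for n x
    unfolding \<theta>_def[abs_def] by (intro grad_fun_lincomb test_fun_smooth \<phi>_approx \<psi>_approx)
  moreover have "(\<lambda>n. L2_norm lebesgue (\<lambda>x. (a *\<^sub>R grad_fun (\<phi> n) x + c *\<^sub>R grad_fun (\<psi> n) x)
      - (a *\<^sub>R g x + c *\<^sub>R k x))) \<longlonglongrightarrow> 0"
    by (intro L2_tendsto_lincomb square_integrable_diff grad_fun_square_integrable
        \<phi>_approx \<psi>_approx g_props k_props)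
  ultimately have "(\<lambda>n. L2_norm lebesgue (\<lambda>x. grad_fun (\<theta> n) x - (a *\<^sub>R g x + c *\<^sub>R k x))) \<longlonglongrightarrow> 0"
    by (simp only:)
  moreover have "Lp_converges (crit_exp TYPE('a)) \<theta> (\<lambda>x. a * u x + c * v x)"
    unfolding \<theta>_def[abs_def] using crit_exp_gt_1[OF assms(1)]
    by (intro Lp_converges_lincomb \<phi>_approx \<psi>_approx) simp
  moreover have "test_fun (\<theta> n)" for n
    unfolding \<theta>_def[abs_def] by (intro test_fun_lincomb \<phi>_approx \<psi>_approx)
  ultimately show ?thesis
    unfolding has_D12_gradient_def
    by (intro conjI exI[of _ \<theta>] allI has_weak_gradient_lincomb square_integrable_lincomb
        g_props k_props)
qed

lemma has_D12_gradient_imp_Lp_crit: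
  fixes u :: "'a::euclidean_space \<Rightarrow> real"
  assumes "DIM('a) \<ge> 3" "has_D12_gradient u g"
  shows "Lp (crit_exp TYPE('a)) u"
proof -
  have "crit_exp TYPE('a) \<ge> 0" using crit_exp_gt_1[OF assms(1)] by simp
  moreover obtain \<phi> where "\<And>k. test_fun (\<phi> k)" "Lp_converges (crit_exp TYPE('a)) \<phi> u"
    by (rule has_D12_gradientE[OF assms(2)]) blast
  ultimately show ?thesis using Lp_converges_limit test_fun_Lp by blast
qed

lemma has_D12_gradient_increment_L2:
  fixes u :: "'a::euclidean_space \<Rightarrow> real"
  assumes dim: "DIM('a) \<ge> 3" and u_D12: "has_D12_gradient u g" and b_Basis: "b \<in> Basis"
  shows "square_integrable lebesgue (\<lambda>x. u (x + t *\<^sub>R b) - u x)"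
    and "L2_norm lebesgue (\<lambda>x. u (x + t *\<^sub>R b) - u x) \<le> \<bar>t\<bar> * L2_norm lebesgue g"
proof -
  note g_props = has_D12_gradientD[OF u_D12]
  obtain \<phi> where \<phi>_approx: "\<And>k. test_fun (\<phi> k)"
    "(\<lambda>k. L2_norm lebesgue (\<lambda>x. grad_fun (\<phi> k) x - g x)) \<longlonglongrightarrow> 0"
    "Lp_converges (crit_exp TYPE('a)) \<phi> u"
    by (rule has_D12_gradientE[OF u_D12]) blast
  have "crit_exp TYPE('a) > 0" using crit_exp_gt_1[OF dim] by simp
  then obtain r where r_mono: "strict_mono r" and lim: "AE x in lebesgue. (\<lambda>n. \<phi> (r n) x) \<longlonglongrightarrow> u x"
    by (rule Lp_converges_AE_subseq[OF \<phi>_approx(3)])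
  have partial_le: "L2_norm lebesgue (partial b (\<phi> k)) \<le> L2_norm lebesgue (grad_fun (\<phi> k))" for k
    using \<phi>_approx(1) b_Basis
    by (intro L2_norm_mono test_fun_square_integrable test_fun_partial grad_fun_square_integrable)
       (auto simp: grad_fun_inner[symmetric] Basis_le_norm)
  have bound: "L2_norm lebesgue (\<lambda>x. \<phi> (r n) (x + t *\<^sub>R b) - \<phi> (r n) x)
      \<le> \<bar>t\<bar> * L2_norm lebesgue (grad_fun (\<phi> (r n)))" for n
    by (rule order_trans[OF test_fun_increment_L2_le[OF \<phi>_approx(1) b_Basis]
      mult_left_mono[OF partial_le abs_ge_zero]])
  have "(\<lambda>k. L2_norm lebesgue (grad_fun (\<phi> k))) \<longlonglongrightarrow> L2_norm lebesgue g"
    by (intro L2_norm_tendsto grad_fun_square_integrable \<phi>_approx g_props)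
  from LIMSEQ_subseq_LIMSEQ[OF this r_mono]
  have bound_lim: "(\<lambda>n. \<bar>t\<bar> * L2_norm lebesgue (grad_fun (\<phi> (r n)))) \<longlonglongrightarrow> \<bar>t\<bar> * L2_norm lebesgue g"
    by (intro tendsto_mult_left) (simp add: o_def)
  have "u \<in> borel_measurable lebesgue" by (rule has_weak_gradient_measurable(1)[OF g_props(1)])
  then have measurable: "(\<lambda>x. u (x + t *\<^sub>R b) - u x) \<in> borel_measurable lebesgue"
    by (intro borel_measurable_diff borel_measurable_lebesgue_shift)
  have "AE x in lebesgue. (\<lambda>n. \<phi> (r n) (x + t *\<^sub>R b) - \<phi> (r n) x) \<longlonglongrightarrow> u (x + t *\<^sub>R b) - u x"
    using lim AE_lebesgue_shift[OF lim, of "t *\<^sub>R b"] by eventually_elim (rule tendsto_diff)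
  note Fatou = L2_Fatou[OF square_integrable_increment[OF test_fun_square_integrable[OF \<phi>_approx(1)]]
      bound bound_lim measurable this]
  show "square_integrable lebesgue (\<lambda>x. u (x + t *\<^sub>R b) - u x)"
    and "L2_norm lebesgue (\<lambda>x. u (x + t *\<^sub>R b) - u x) \<le> \<bar>t\<bar> * L2_norm lebesgue g"
    by (rule Fatou)+
qed

lemma has_D12_gradient_second_difference_L2:
  fixes u :: "'a::euclidean_space \<Rightarrow> real" and t :: real
  assumes dim: "DIM('a) \<ge> 3" and u_D12: "has_D12_gradient u g" and b_Basis: "b \<in> Basis"
  defines "h \<equiv> t *\<^sub>R b"
  shows "square_integrable lebesgue (\<lambda>x. 2 * u x - u (x + h) - u (x - h))"
    and "L2_norm lebesgue (\<lambda>x. 2 * u x - u (x + h) - u (x - h))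
        \<le> \<bar>t\<bar> * L2_norm lebesgue (\<lambda>x. g (x + h) - g x)"
proof -
  have "has_D12_gradient (\<lambda>x. u (x + h) - u x) (\<lambda>x. g (x + h) - g x)"
    using has_D12_gradient_lincomb[OF dim has_D12_gradient_shift[OF u_D12] u_D12, of 1 h "-1"]
    by simp
  from has_D12_gradient_increment_L2[OF dim this b_Basis, of "- t"]
  show "square_integrable lebesgue (\<lambda>x. 2 * u x - u (x + h) - u (x - h))"
    and "L2_norm lebesgue (\<lambda>x. 2 * u x - u (x + h) - u (x - h))
        \<le> \<bar>t\<bar> * L2_norm lebesgue (\<lambda>x. g (x + h) - g x)"
    by (simp_all add: h_def algebra_simps)
qed

lemma has_D12_gradient_mult_integrable:
  fixes u \<rho> :: "'a::euclidean_space \<Rightarrow> real"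
  assumes dim: "DIM('a) \<ge> 3" and u_D12: "has_D12_gradient u g"
    and \<rho>_Lp: "Lp (2 * real DIM('a) / (real DIM('a) + 2)) \<rho>"
  shows "integrable lebesgue (\<lambda>x. \<rho> x * u x)"
proof (rule Lp_mult_integrable[OF \<rho>_Lp])
  show "Lp (crit_exp TYPE('a)) u" by (rule has_D12_gradient_imp_Lp_crit[OF dim u_D12])
  show "1 < crit_exp TYPE('a)" by (rule crit_exp_gt_1[OF dim])
  have "real DIM('a) \<ge> 3" using dim by simp
  then show "1 < 2 * real DIM('a) / (real DIM('a) + 2)"
    "1 / (2 * real DIM('a) / (real DIM('a) + 2)) + 1 / crit_exp TYPE('a) = 1"
    by (auto simp: crit_exp_def field_simps)
qed

subsection \<open>The constraint set\<close>

definition Xset_gradient :: "('a::euclidean_space \<Rightarrow> real) \<Rightarrow> ('a \<Rightarrow> 'a) \<Rightarrow> bool" where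
  "Xset_gradient u g \<longleftrightarrow> has_D12_gradient u g \<and> (AE x in lebesgue. norm (g x) \<le> 1)"

lemma Xset_gradientD:
  assumes "Xset_gradient u g"
  shows "has_D12_gradient u g" "has_weak_gradient u g" "square_integrable lebesgue g"
    "AE x in lebesgue. norm (g x) \<le> 1"
  using assms has_D12_gradientD by (auto simp: Xset_gradient_def)

lemma Xset_iff: "u \<in> Xset \<longleftrightarrow> (\<exists>g. Xset_gradient u g) \<and> (\<exists>L. L-lipschitz_on UNIV u)"
proof -
  have "AE x in lebesgue. norm (g x) \<le> 1"
    if "has_D12_gradient u g" "has_weak_gradient u k" "AE x in lebesgue. norm (k x) \<le> 1" for g k
    using that(3) has_weak_gradient_unique[OF has_D12_gradientD(1)[OF that(1)] that(2)]
    by eventually_elim simp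
  then show ?thesis
    unfolding Xset_def Xset_gradient_def D12_iff mem_Collect_eq
    by (blast dest: has_D12_gradientD(1))
qed

lemma Xset_gradient_shift:
  "Xset_gradient u g \<Longrightarrow> Xset_gradient (\<lambda>x. u (x + h)) (\<lambda>x. g (x + h))"
  by (simp add: Xset_gradient_def has_D12_gradient_shift
      AE_lebesgue_shift[where P="\<lambda>x. norm (g x) \<le> 1"])

lemma Xset_gradient_convex:
  fixes u v :: "'a::euclidean_space \<Rightarrow> real"
  assumes "DIM('a) \<ge> 3" and u_grad: "Xset_gradient u g" and v_grad: "Xset_gradient v k"
    and "0 \<le> a" "0 \<le> c" "a + c = 1"
  shows "Xset_gradient (\<lambda>x. a * u x + c * v x) (\<lambda>x. a *\<^sub>R g x + c *\<^sub>R k x)"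
  unfolding Xset_gradient_def
proof
  show "has_D12_gradient (\<lambda>x. a * u x + c * v x) (\<lambda>x. a *\<^sub>R g x + c *\<^sub>R k x)"
    by (intro has_D12_gradient_lincomb assms Xset_gradientD(1)[OF u_grad]
      Xset_gradientD(1)[OF v_grad])
  show "AE x in lebesgue. norm (a *\<^sub>R g x + c *\<^sub>R k x) \<le> 1"
    using Xset_gradientD(4)[OF u_grad] Xset_gradientD(4)[OF v_grad]
  proof eventually_elim
    case (elim x)
    then show ?case
      using convexD[OF convex_cball[of 0 1], of "g x" "k x" a c] assms(4-6) by simp
  qed
qed

lemma Xset_shift:
  assumes "u \<in> Xset"
  shows "(\<lambda>x. u (x + h)) \<in> Xset"
proof -
  obtain g L where "Xset_gradient u g" and u_Lipschitz: "L-lipschitz_on UNIV u"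
    using assms by (auto simp: Xset_iff)
  moreover have "L-lipschitz_on UNIV (\<lambda>x. u (x + h))"
    using lipschitz_onD[OF u_Lipschitz, of "_ + h" "_ + h"] lipschitz_on_nonneg[OF u_Lipschitz]
    by (auto intro: lipschitz_onI)
  ultimately show ?thesis using Xset_gradient_shift Xset_iff by blast
qed

lemma Xset_convex:
  fixes u v :: "'a::euclidean_space \<Rightarrow> real"
  assumes "DIM('a) \<ge> 3" "u \<in> Xset" "v \<in> Xset" "0 \<le> a" "0 \<le> c" "a + c = 1"
  shows "(\<lambda>x. a * u x + c * v x) \<in> Xset"
proof -
  obtain g L k L' where "Xset_gradient u g" "L-lipschitz_on UNIV u" "Xset_gradient v k"
    "L'-lipschitz_on UNIV v"
    using assms by (auto simp: Xset_iff)
  moreover from this have "(\<bar>a\<bar> * L + \<bar>c\<bar> * L')-lipschitz_on UNIV (\<lambda>x. a * u x + c * v x)"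
    by (intro lipschitz_on_add lipschitz_on_cmult_real)
  ultimately show ?thesis using Xset_gradient_convex[OF assms(1)] assms(4-6) Xset_iff by blast
qed

section \<open>The Born--Infeld energy\<close>

definition born_infeld_density :: "'a::euclidean_space \<Rightarrow> real" where
  "born_infeld_density p = 1 - sqrt (1 - (norm p)\<^sup>2)"

definition born_infeld_energy :: "('a::euclidean_space \<Rightarrow> 'a) \<Rightarrow> real" where
  "born_infeld_energy g = (\<integral>x. born_infeld_density (g x) \<partial>lebesgue)"

lemma power2_norm_midpoint:
  fixes p q :: "'a::euclidean_space"
  shows "(norm ((1/2) *\<^sub>R p + (1/2) *\<^sub>R q))\<^sup>2
      = ((norm p)\<^sup>2 + (norm q)\<^sup>2) / 2 - (norm (p - q))\<^sup>2 / 4"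
  unfolding power2_norm_eq_inner by (simp add: inner_simps inner_commute field_simps)

text \<open>The points \<open>(p, sqrt (1 - |p|\<^sup>2))\<close> lie on the unit sphere, so the parallelogram identity
  measures how far the graph of the root lies above the midpoint of a chord.\<close>

lemma born_infeld_density_uniformly_convex:
  fixes p q :: "'a::euclidean_space"
  assumes "norm p \<le> 1" "norm q \<le> 1"
  shows "born_infeld_density ((1/2) *\<^sub>R p + (1/2) *\<^sub>R q)
    \<le> 1/2 * born_infeld_density p + 1/2 * born_infeld_density q - 1/16 * (norm (p - q))\<^sup>2"
proof -
  define a where "a = sqrt (1 - (norm p)\<^sup>2)"
  define b where "b = sqrt (1 - (norm q)\<^sup>2)"
  define d where "d = (norm (p - q))\<^sup>2"
  have a_props: "a\<^sup>2 = 1 - (norm p)\<^sup>2" "0 \<le> a" "a \<le> 1"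
    and b_props: "b\<^sup>2 = 1 - (norm q)\<^sup>2" "0 \<le> b" "b \<le> 1"
    using assms by (auto simp: a_def b_def power_le_one)
  have "norm (p - q) \<le> 2" using norm_triangle_ineq4[of p q] assms by linarith
  then have d_bounds: "0 \<le> d" "d \<le> 4"
    using power_mono[of "norm (p - q)" 2 2] by (auto simp: d_def)
  have "((a + b) / 2 + d / 16)\<^sup>2 = ((a + b) / 2)\<^sup>2 + (a + b) * d / 16 + d * d / 256"
    by (simp add: power2_eq_square field_simps)
  also have "\<dots> \<le> (a\<^sup>2 + b\<^sup>2) / 2 + 2 * d / 16 + 4 * d / 256"
  proof -
    have "((a + b) / 2)\<^sup>2 \<le> (a\<^sup>2 + b\<^sup>2) / 2"
      using sum_squares_bound[of a b] by (simp add: power2_eq_square field_simps)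
    moreover have "(a + b) * d \<le> 2 * d" "d * d \<le> 4 * d"
      using a_props b_props d_bounds by (auto intro!: mult_right_mono)
    ultimately show ?thesis by linarith
  qed
  also have "\<dots> \<le> (a\<^sup>2 + b\<^sup>2) / 2 + d / 4"
    using d_bounds by simp
  also have "\<dots> = 1 - (norm ((1/2) *\<^sub>R p + (1/2) *\<^sub>R q))\<^sup>2"
    unfolding power2_norm_midpoint a_props(1) b_props(1) d_def by (simp add: field_simps)
  finally have "(a + b) / 2 + d / 16 \<le> sqrt (1 - (norm ((1/2) *\<^sub>R p + (1/2) *\<^sub>R q))\<^sup>2)"
    by (rule real_le_rsqrt)
  then show ?thesis unfolding born_infeld_density_def a_def b_def d_def by argo
qed

lemma born_infeld_density_bounds:
  assumes "norm p \<le> 1"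
  shows "0 \<le> born_infeld_density p" "born_infeld_density p \<le> (norm p)\<^sup>2"
proof -
  have root_arg: "0 \<le> 1 - (norm p)\<^sup>2" "1 - (norm p)\<^sup>2 \<le> 1" using assms by (auto simp: power_le_one)
  then show "0 \<le> born_infeld_density p" by (simp add: born_infeld_density_def)
  have "1 - (norm p)\<^sup>2 \<le> sqrt (1 - (norm p)\<^sup>2)"
    using root_arg by (intro real_le_rsqrt) (simp add: power2_eq_square mult_left_le)
  then show "born_infeld_density p \<le> (norm p)\<^sup>2" by (simp add: born_infeld_density_def)
qed

lemma born_infeld_density_measurable [measurable]: "born_infeld_density \<in> borel_measurable borel"
  unfolding born_infeld_density_def[abs_def] by measurable

lemma born_infeld_density_integrable:
  assumes [measurable]: "square_integrable M g" and bound: "AE x in M. norm (g x) \<le> 1"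
  shows "integrable M (\<lambda>x. born_infeld_density (g x))"
proof (rule Bochner_Integration.integrable_bound)
  show "integrable M (\<lambda>x. (norm (g x))\<^sup>2)"
    by (rule square_integrable_integrable_norm_power2[OF assms(1)])
  show "AE x in M. norm (born_infeld_density (g x)) \<le> norm ((norm (g x))\<^sup>2)"
    using bound by eventually_elim (simp add: born_infeld_density_bounds)
qed measurable

lemma born_infeld_energy_shift:
  assumes [measurable]: "g \<in> borel_measurable lebesgue"
  shows "born_infeld_energy (\<lambda>x. g (x + h)) = born_infeld_energy g"
  unfolding born_infeld_energy_def
  by (rule integral_lebesgue_shift[where f="\<lambda>x. born_infeld_density (g x)"]) measurable

lemma born_infeld_energy_midpoint:
  assumes g_admissible: "square_integrable lebesgue g" "AE x in lebesgue. norm (g x) \<le> 1"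
    and k_admissible: "square_integrable lebesgue k" "AE x in lebesgue. norm (k x) \<le> 1"
  shows "born_infeld_energy (\<lambda>x. (1/2) *\<^sub>R g x + (1/2) *\<^sub>R k x)
    \<le> 1/2 * born_infeld_energy g + 1/2 * born_infeld_energy k
      - 1/16 * (L2_norm lebesgue (\<lambda>x. g x - k x))\<^sup>2"
proof -
  let ?F = "born_infeld_density"
  note integrable_rhs = born_infeld_density_integrable[OF g_admissible]
    born_infeld_density_integrable[OF k_admissible]
    square_integrable_integrable_norm_power2[OF
      square_integrable_diff[OF g_admissible(1) k_admissible(1)]]
  have "born_infeld_energy (\<lambda>x. (1/2) *\<^sub>R g x + (1/2) *\<^sub>R k x)
      \<le> (\<integral>x. 1/2 * ?F (g x) + 1/2 * ?F (k x) - 1/16 * (norm (g x - k x))\<^sup>2 \<partial>lebesgue)"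
    unfolding born_infeld_energy_def
  proof (rule integral_mono_AE)
    have "AE x in lebesgue. norm ((1/2) *\<^sub>R g x + (1/2) *\<^sub>R k x) \<le> 1"
      using g_admissible(2) k_admissible(2) by eventually_elim (rule norm_triangle_le, simp)
    then show "integrable lebesgue (\<lambda>x. ?F ((1/2) *\<^sub>R g x + (1/2) *\<^sub>R k x))"
      by (intro born_infeld_density_integrable square_integrable_lincomb g_admissible k_admissible)
    show "integrable lebesgue (\<lambda>x. 1/2 * ?F (g x) + 1/2 * ?F (k x) - 1/16 * (norm (g x - k x))\<^sup>2)"
      using integrable_rhs by simp
    show "AE x in lebesgue. ?F ((1/2) *\<^sub>R g x + (1/2) *\<^sub>R k x)
        \<le> 1/2 * ?F (g x) + 1/2 * ?F (k x) - 1/16 * (norm (g x - k x))\<^sup>2"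
      using g_admissible(2) k_admissible(2)
      by eventually_elim (rule born_infeld_density_uniformly_convex)
  qed
  also have "\<dots> = 1/2 * born_infeld_energy g + 1/2 * born_infeld_energy k
      - 1/16 * (L2_norm lebesgue (\<lambda>x. g x - k x))\<^sup>2"
    using integrable_rhs by (simp add: born_infeld_energy_def L2_norm_power2)
  finally show ?thesis .
qed

lemma I_rho_eq:
  assumes grad: "has_weak_gradient u g"
  shows "I_rho \<rho> u = born_infeld_energy g - (\<integral>x. \<rho> x * u x \<partial>lebesgue)"
proof -
  note weak_grad = has_weak_gradient_weak_grad[OF grad]
  note [measurable] = has_weak_gradient_measurable(2)[OF grad]
    has_weak_gradient_measurable(2)[OF weak_grad]
  have "(\<integral>x. born_infeld_density (weak_grad u x) \<partial>lebesgue) = born_infeld_energy g"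
    unfolding born_infeld_energy_def
  proof (rule integral_cong_AE)
    show "AE x in lebesgue. born_infeld_density (weak_grad u x) = born_infeld_density (g x)"
      using has_weak_gradient_unique[OF weak_grad grad] by eventually_elim simp
  qed measurable
  then show ?thesis by (simp add: I_rho_def born_infeld_density_def)
qed

lemma I_rho_midpoint:
  assumes u_grad: "Xset_gradient u g" and v_grad: "Xset_gradient v k"
    and integrable: "integrable lebesgue (\<lambda>x. \<rho> x * u x)" "integrable lebesgue (\<lambda>x. \<rho> x * v x)"
  shows "I_rho \<rho> (\<lambda>x. 1/2 * u x + 1/2 * v x)
    \<le> 1/2 * I_rho \<rho> u + 1/2 * I_rho \<rho> v - 1/16 * (L2_norm lebesgue (\<lambda>x. g x - k x))\<^sup>2"
proof -
  note g_props = Xset_gradientD[OF u_grad] and k_props = Xset_gradientD[OF v_grad]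
  have "(\<integral>x. \<rho> x * (1/2 * u x + 1/2 * v x) \<partial>lebesgue)
      = 1/2 * (\<integral>x. \<rho> x * u x \<partial>lebesgue) + 1/2 * (\<integral>x. \<rho> x * v x \<partial>lebesgue)"
    using integrable by (simp add: distrib_left)
  then show ?thesis
    using born_infeld_energy_midpoint[OF g_props(3,4) k_props(3,4)]
    unfolding I_rho_eq[OF g_props(2)] I_rho_eq[OF k_props(2)]
      I_rho_eq[OF has_weak_gradient_lincomb[OF g_props(2) k_props(2)]]
    by argo
qed

section \<open>Regularity of the minimizer\<close>

lemma minimizer_gap:
  fixes u v :: "'a::euclidean_space \<Rightarrow> real"
  assumes dim: "DIM('a) \<ge> 3" and minimizer: "is_arg_min (I_rho \<rho>) (\<lambda>w. w \<in> Xset) u"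
    and "v \<in> Xset" and grad: "Xset_gradient u g" "Xset_gradient v k"
    and integrable: "integrable lebesgue (\<lambda>x. \<rho> x * u x)" "integrable lebesgue (\<lambda>x. \<rho> x * v x)"
  shows "1/8 * (L2_norm lebesgue (\<lambda>x. g x - k x))\<^sup>2 \<le> I_rho \<rho> v - I_rho \<rho> u"
proof -
  have "u \<in> Xset" using minimizer by (simp add: is_arg_min_linorder)
  then have "(\<lambda>x. 1/2 * u x + 1/2 * v x) \<in> Xset"
    by (intro Xset_convex dim \<open>v \<in> Xset\<close>) auto
  then have "I_rho \<rho> u \<le> I_rho \<rho> (\<lambda>x. 1/2 * u x + 1/2 * v x)"
    using minimizer by (simp add: is_arg_min_linorder)
  with I_rho_midpoint[OF grad integrable] show ?thesis by argo
qed

lemma minimizer_translation_gap: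
  fixes u :: "'a::euclidean_space \<Rightarrow> real"
  assumes dim: "DIM('a) \<ge> 3" and minimizer: "is_arg_min (I_rho \<rho>) (\<lambda>w. w \<in> Xset) u"
    and grad: "Xset_gradient u g"
    and integrable: "\<And>h. integrable lebesgue (\<lambda>x. \<rho> x * u (x + h))"
  shows "1/8 * (L2_norm lebesgue (\<lambda>x. g (x + h) - g x))\<^sup>2
    \<le> (\<integral>x. \<rho> x * u x \<partial>lebesgue) - (\<integral>x. \<rho> x * u (x + h) \<partial>lebesgue)"
proof -
  note g_props = Xset_gradientD[OF grad]
  have "I_rho \<rho> (\<lambda>x. u (x + h)) - I_rho \<rho> u
      = (\<integral>x. \<rho> x * u x \<partial>lebesgue) - (\<integral>x. \<rho> x * u (x + h) \<partial>lebesgue)"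
    unfolding I_rho_eq[OF g_props(2)] I_rho_eq[OF has_weak_gradient_shift[OF g_props(2)]]
    by (simp add: born_infeld_energy_shift square_integrable_measurable g_props(3))
  moreover have "1/8 * (L2_norm lebesgue (\<lambda>x. g x - g (x + h)))\<^sup>2
      \<le> I_rho \<rho> (\<lambda>x. u (x + h)) - I_rho \<rho> u"
    using minimizer integrable[of 0]
    by (intro minimizer_gap[OF dim minimizer] Xset_shift Xset_gradient_shift grad integrable)
       (simp_all add: is_arg_min_linorder)
  ultimately show ?thesis by (simp only: L2_norm_diff_commute[of _ g])
qed

theorem minimizer_gradient_increment:
  fixes u :: "'a::euclidean_space \<Rightarrow> real"
  assumes dim: "DIM('a) \<ge> 3" and minimizer: "is_arg_min (I_rho \<rho>) (\<lambda>w. w \<in> Xset) u"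
    and grad: "Xset_gradient u g"
    and integrable: "\<And>h. integrable lebesgue (\<lambda>x. \<rho> x * u (x + h))"
    and \<rho>_L2: "square_integrable lebesgue \<rho>" and b_Basis: "b \<in> Basis"
  shows "L2_norm lebesgue (\<lambda>x. g (x + t *\<^sub>R b) - g x) \<le> 4 * L2_norm lebesgue \<rho> * \<bar>t\<bar>"
proof -
  define h where "h = t *\<^sub>R b"
  define Q where "Q = L2_norm lebesgue (\<lambda>x. g (x + h) - g x)"
  define S where "S x = 2 * u x - u (x + h) - u (x - h)" for x
  note g_props = Xset_gradientD[OF grad]
  have S_L2: "square_integrable lebesgue S" "L2_norm lebesgue S \<le> \<bar>t\<bar> * Q"
    unfolding S_def[abs_def] Q_def h_def
    by (rule has_D12_gradient_second_difference_L2[OF dim g_props(1) b_Basis])+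
  have "1/8 * Q\<^sup>2 \<le> (\<integral>x. \<rho> x * u x \<partial>lebesgue) - (\<integral>x. \<rho> x * u (x + h) \<partial>lebesgue)"
    unfolding Q_def by (rule minimizer_translation_gap[OF dim minimizer grad integrable])
  moreover have "1/8 * Q\<^sup>2 \<le> (\<integral>x. \<rho> x * u x \<partial>lebesgue) - (\<integral>x. \<rho> x * u (x - h) \<partial>lebesgue)"
    using minimizer_translation_gap[OF dim minimizer grad integrable, of "- h"]
      L2_norm_increment_uminus[OF g_props(3)]
    by (simp add: Q_def)
  moreover have "(\<integral>x. \<rho> x \<bullet> S x \<partial>lebesgue) = 2 * (\<integral>x. \<rho> x * u x \<partial>lebesgue)
      - (\<integral>x. \<rho> x * u (x + h) \<partial>lebesgue) - (\<integral>x. \<rho> x * u (x - h) \<partial>lebesgue)"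
  proof -
    have "\<rho> x \<bullet> S x = 2 * (\<rho> x * u x) - \<rho> x * u (x + h) - \<rho> x * u (x - h)" for x
      by (simp add: S_def algebra_simps)
    then show ?thesis
      using integrable[of 0] integrable[of h] integrable[of "- h"] by simp
  qed
  ultimately have "1/4 * Q\<^sup>2 \<le> (\<integral>x. \<rho> x \<bullet> S x \<partial>lebesgue)" by linarith
  also have "\<dots> \<le> L2_norm lebesgue \<rho> * (\<bar>t\<bar> * Q)"
    using L2_Cauchy_Schwarz[OF \<rho>_L2 S_L2(1)]
      mult_left_mono[OF S_L2(2) L2_norm_nonneg, of lebesgue \<rho>]
    by linarith
  finally have "Q * Q \<le> 4 * L2_norm lebesgue \<rho> * \<bar>t\<bar> * Q"
    by (simp add: power2_eq_square)
  moreover have "Q \<ge> 0" "0 \<le> 4 * L2_norm lebesgue \<rho> * \<bar>t\<bar>" by (simp_all add: Q_def L2_norm_nonneg)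
  ultimately have "Q \<le> 4 * L2_norm lebesgue \<rho> * \<bar>t\<bar>" by (cases "Q = 0") auto
  then show ?thesis by (simp add: Q_def h_def)
qed

theorem theorem1p5:
  fixes \<rho> u :: "'a::euclidean_space \<Rightarrow> real" and q m :: real
  assumes "DIM('a) \<ge> 3"
    and "q > 2 * real DIM('a)"
    and "1 \<le> m" and "m \<le> 2 * real DIM('a) / (real DIM('a) + 2)"
    and "Lp q \<rho>" and "Lp m \<rho>"
    and "u \<in> Xset"
    and "\<forall>v\<in>Xset. I_rho \<rho> u \<le> I_rho \<rho> v"
  shows "W22_loc u"
proof -
  let ?N = "real DIM('a)"
  obtain g L where grad: "Xset_gradient u g" and lipschitz: "L-lipschitz_on UNIV u"
    using assms(7) by (auto simp: Xset_iff)
  note g_props = Xset_gradientD[OF grad]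
  have minimizer: "is_arg_min (I_rho \<rho>) (\<lambda>v. v \<in> Xset) u"
    using assms(7,8) by (simp add: is_arg_min_linorder)
  have "2 * ?N / (?N + 2) \<le> 2" "2 \<le> q"
    using assms(1,2) by (auto simp: divide_le_eq)
  then have "Lp (2 * ?N / (?N + 2)) \<rho>" and \<rho>_L2: "square_integrable lebesgue \<rho>"
    using Lp_interpolate[OF assms(6,5)] assms(4) by (auto simp flip: Lp_2_iff)
  then have "integrable lebesgue (\<lambda>x. \<rho> x * u (x + h))" for h
    by (intro has_D12_gradient_mult_integrable[OF assms(1) has_D12_gradient_shift[OF g_props(1)]])
  then have "L2_norm lebesgue (\<lambda>x. g (x + t *\<^sub>R b) - g x) \<le> 4 * L2_norm lebesgue \<rho> * \<bar>t\<bar>"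
    if "b \<in> Basis" for b t
    by (intro minimizer_gradient_increment[OF assms(1) minimizer grad _ \<rho>_L2 that])
  moreover have "L2_loc u"
    by (intro continuous_imp_L2_loc lipschitz_on_continuous_on[OF lipschitz])
  ultimately show ?thesis
    by (intro W22_loc_of_bounded_gradient_increments[OF _ g_props(2,3)])
qed

end
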